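(* Let $G\in\mathcal{G}$ be an infinite graph. Then $G$ is isomorphic to one of the following ten graphs: the both-side infinite line, the one-side infinite line, the infinite ladder, or one of the seven infinite quasi-ladders.
   Context: All graphs are undirected, connected, locally finite and simple, $G=(V,E)$, with combinatorial distance $d$. $\deg(u)$ is the number of neighbors of $u$; $\mathrm{diam}(G)=\sup\{d(u,v):u,v\in V\}\in[0,\infty]$. Curvature (combinatorial graph: all edge weights and vertex weights equal to $1$). For small $\varepsilon>0$ let $\mu_u^\varepsilon$ be the probability measure with $\mu_u^\varepsilon(u)=1-\varepsilon\deg(u)$, $\mu_u^\varepsilon(v)=\varepsilon$ if $v\sim u$, and $0$ otherwise. The Wasserstein distance is $W(\mu,\nu)=\inf_A\sum_{u,v\in V}A(u,v)d(u,v)$, the infimum over all couplings $A:V\times V\to[0,1]$ with $\sum_v A(u,v)=\mu(u)$ and $\sum_u A(u,v)=\nu(v)$. Put $\kappa_\varepsilon(u,v)=1-W(\mu_u^\varepsilon,\mu_v^\varepsilon)/d(u,v)$; the Lin-Lu-Yau-Ollivier Ricci curvature is $\kappa(u,v)=\lim_{\varepsilon\to0^+}\frac1\varepsilon\kappa_\varepsilon(u,v)$ (the limit exists). $\mathcal{G}$ is the class of such graphs $G$ with $\deg(u)\le 3$ for all $u\in V$, $\kappa(u,v)\ge 0$ for every edge $uv\in E$, and $\mathrm{diam}(G)\ge 6$. Both-side infinite line: vertex set $\mathbb{Z}$, $n\sim n+1$. One-side infinite line: vertex set $\{0,1,2,\dots\}$, $n\sim n+1$. Infinite ladder: Cartesian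 product of the both-side infinite line with $K_2$. Infinite quasi-ladders: take the half-infinite ladder with vertices $x_n,y_n$ ($n\ge0$) and edges $x_ny_n$, $x_nx_{n+1}$, $y_ny_{n+1}$ ($n\ge 0$), and perform one of the following seven modifications at its end, with $x=x_0$, $y=y_0$: (E1) nothing; (E2) attach one pendant vertex to exactly one of $x,y$; (E3) attach one pendant vertex to $x$ and another one to $y$; (E4) add a vertex $z$ adjacent to $x$ and $y$; (E5) as (E4), and add a pendant vertex attached to $z$; (E6) add vertices $a,b,c$ with edges $xa,\ yb,\ ac,\ bc$; (E7) as (E6), and add a pendant vertex attached to $c$. *)

theory Defs
  imports "HOL-Analysis.Analysis" "HOL-Library.Extended_Nat"
begin

text \<open>
  An undirected graph is given by a vertex set and a symmetric adjacency relation: an undirected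
  edge \<open>uv\<close> is represented by the two pairs \<open>(u, v)\<close> and \<open>(v, u)\<close>.
\<close>

record 'v ugraph =
  verts :: "'v set"
  adj :: "'v rel"

definition simple_graph :: "'v ugraph \<Rightarrow> bool" where
  "simple_graph G \<longleftrightarrow> adj G \<subseteq> verts G \<times> verts G \<and> sym (adj G) \<and> irrefl (adj G)"

definition graph_connected :: "'v ugraph \<Rightarrow> bool" where
  "graph_connected G \<longleftrightarrow> (\<forall>u\<in>verts G. \<forall>v\<in>verts G. (u, v) \<in> (adj G)\<^sup>*)"

definition nbrs :: "'v ugraph \<Rightarrow> 'v \<Rightarrow> 'v set" where
  "nbrs G u = {v. (u, v) \<in> adj G}"

definition locally_finite :: "'v ugraph \<Rightarrow> bool" where
  "locally_finite G \<longleftrightarrow> (\<forall>u\<in>verts G. finite (nbrs G u))"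

definition vdeg :: "'v ugraph \<Rightarrow> 'v \<Rightarrow> nat" where
  "vdeg G u = card (nbrs G u)"

text \<open>The length of a shortest walk; only meaningful for vertices in the same component.\<close>

definition gdist :: "'v ugraph \<Rightarrow> 'v \<Rightarrow> 'v \<Rightarrow> nat" where
  "gdist G u v = (LEAST n. (u, v) \<in> adj G ^^ n)"

definition diam :: "'v ugraph \<Rightarrow> enat" where
  "diam G = (SUP u\<in>verts G. SUP v\<in>verts G. enat (gdist G u v))"

definition lazy_measure :: "'v ugraph \<Rightarrow> real \<Rightarrow> 'v \<Rightarrow> 'v \<Rightarrow> real" where
  "lazy_measure G \<epsilon> u w =
     (if w = u then 1 - \<epsilon> * real (vdeg G u) else if (u, w) \<in> adj G then \<epsilon> else 0)"

definition is_coupling ::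
  "'v ugraph \<Rightarrow> ('v \<Rightarrow> real) \<Rightarrow> ('v \<Rightarrow> real) \<Rightarrow> ('v \<Rightarrow> 'v \<Rightarrow> real) \<Rightarrow> bool" where
  "is_coupling G \<mu> \<nu> A \<longleftrightarrow>
     (\<forall>u\<in>verts G. \<forall>v\<in>verts G. A u v \<in> {0..1}) \<and>
     (\<forall>u\<in>verts G. ((\<lambda>v. A u v) has_sum \<mu> u) (verts G)) \<and>
     (\<forall>v\<in>verts G. ((\<lambda>u. A u v) has_sum \<nu> v) (verts G))"

text \<open>
  Couplings of infinite cost are discarded, which does not affect the infimum as soon as some
  coupling has finite cost; this is always so for finitely supported probability measures.
\<close>

definition wasserstein :: "'v ugraph \<Rightarrow> ('v \<Rightarrow> real) \<Rightarrow> ('v \<Rightarrow> real) \<Rightarrow> real" where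
  "wasserstein G \<mu> \<nu> =
     Inf {c. \<exists>A. is_coupling G \<mu> \<nu> A \<and>
               ((\<lambda>(u, v). A u v * real (gdist G u v)) has_sum c) (verts G \<times> verts G)}"

definition kappa_eps :: "'v ugraph \<Rightarrow> real \<Rightarrow> 'v \<Rightarrow> 'v \<Rightarrow> real" where
  "kappa_eps G \<epsilon> u v =
     1 - wasserstein G (lazy_measure G \<epsilon> u) (lazy_measure G \<epsilon> v) / real (gdist G u v)"

definition curvature :: "'v ugraph \<Rightarrow> 'v \<Rightarrow> 'v \<Rightarrow> real" where
  "curvature G u v = Lim (at_right 0) (\<lambda>\<epsilon>. 1 / \<epsilon> * kappa_eps G \<epsilon> u v)"

definition in_class_G :: "'v ugraph \<Rightarrow> bool" where
  "in_class_G G \<longleftrightarrow>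
     simple_graph G \<and> graph_connected G \<and> locally_finite G \<and>
     (\<forall>u\<in>verts G. vdeg G u \<le> 3) \<and>
     (\<forall>(u, v)\<in>adj G. curvature G u v \<ge> 0) \<and>
     diam G \<ge> 6"

definition graph_iso :: "'v ugraph \<Rightarrow> 'w ugraph \<Rightarrow> bool" (infix "\<simeq>\<^sub>G" 50) where
  "G \<simeq>\<^sub>G H \<longleftrightarrow>
     (\<exists>f. bij_betw f (verts G) (verts H) \<and>
          (\<forall>u\<in>verts G. \<forall>v\<in>verts G. (u, v) \<in> adj G \<longleftrightarrow> (f u, f v) \<in> adj H))"

definition sym_closure :: "'v rel \<Rightarrow> 'v rel" where
  "sym_closure R = R \<union> R\<inverse>"

definition both_side_line :: "int ugraph" where
  "both_side_line = \<lparr>verts = UNIV, adj = sym_closure {(n, n + 1) |n. True}\<rparr>"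

definition one_side_line :: "nat ugraph" where
  "one_side_line = \<lparr>verts = UNIV, adj = sym_closure {(n, n + 1) |n. True}\<rparr>"

definition K2 :: "bool ugraph" where
  "K2 = \<lparr>verts = UNIV, adj = sym_closure {(False, True)}\<rparr>"

definition cartesian_product :: "'v ugraph \<Rightarrow> 'w ugraph \<Rightarrow> ('v \<times> 'w) ugraph" where
  "cartesian_product G H =
     \<lparr>verts = verts G \<times> verts H,
      adj = {((a, b), (a', b')). (a = a' \<and> a \<in> verts G \<and> (b, b') \<in> adj H) \<or>
                                 ((a, a') \<in> adj G \<and> b = b' \<and> b \<in> verts H)}\<rparr>"

definition infinite_ladder :: "(int \<times> bool) ugraph" where
  "infinite_ladder = cartesian_product both_side_line K2"

text \<open>
  Vertices of the quasi-ladders: the two sides \<open>x\<^sub>n\<close>, \<open>y\<^sub>n\<close> of the half-infinite ladder, the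
  vertices \<open>z\<close>, \<open>a\<close>, \<open>b\<close>, \<open>c\<close> that may be added at its end, and up to two pendant vertices
  \<open>p\<close>, \<open>q\<close>.
\<close>

datatype qvertex = Vx nat | Vy nat | Vz | Va | Vb | Vc | Vp | Vq

definition half_ladder_edges :: "qvertex rel" where
  "half_ladder_edges =
     {(Vx n, Vy n) |n. True} \<union> {(Vx n, Vx (n + 1)) |n. True} \<union> {(Vy n, Vy (n + 1)) |n. True}"

definition half_ladder_with :: "qvertex set \<Rightarrow> qvertex rel \<Rightarrow> qvertex ugraph" where
  "half_ladder_with W F =
     \<lparr>verts = range Vx \<union> range Vy \<union> W, adj = sym_closure (half_ladder_edges \<union> F)\<rparr>"

definition quasi_ladder_E1 :: "qvertex ugraph" where
  "quasi_ladder_E1 = half_ladder_with {} {}"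

text \<open>Attaching the pendant vertex to \<open>y\<close> instead of \<open>x\<close> yields an isomorphic graph.\<close>

definition quasi_ladder_E2 :: "qvertex ugraph" where
  "quasi_ladder_E2 = half_ladder_with {Vp} {(Vp, Vx 0)}"

definition quasi_ladder_E3 :: "qvertex ugraph" where
  "quasi_ladder_E3 = half_ladder_with {Vp, Vq} {(Vp, Vx 0), (Vq, Vy 0)}"

definition quasi_ladder_E4 :: "qvertex ugraph" where
  "quasi_ladder_E4 = half_ladder_with {Vz} {(Vz, Vx 0), (Vz, Vy 0)}"

definition quasi_ladder_E5 :: "qvertex ugraph" where
  "quasi_ladder_E5 = half_ladder_with {Vz, Vp} {(Vz, Vx 0), (Vz, Vy 0), (Vp, Vz)}"

definition quasi_ladder_E6 :: "qvertex ugraph" where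
  "quasi_ladder_E6 =
     half_ladder_with {Va, Vb, Vc} {(Vx 0, Va), (Vy 0, Vb), (Va, Vc), (Vb, Vc)}"

definition quasi_ladder_E7 :: "qvertex ugraph" where
  "quasi_ladder_E7 =
     half_ladder_with {Va, Vb, Vc, Vp} {(Vx 0, Va), (Vy 0, Vb), (Va, Vc), (Vb, Vc), (Vp, Vc)}"

end

theory Submission
  imports Defs
begin

text \<open>
  By the easy half of Kantorovich duality, \<open>\<kappa>(u, v) \<ge> 0\<close> forces \<open>\<Delta>f(v) \<le> \<Delta>f(u)\<close> for every 1-Lipschitz
  \<open>f\<close> with \<open>f(v) = f(u) + 1\<close>, and nothing else about the curvature is needed.  If a vertex \<open>x\<^sub>0\<close> has
  degree 3, take a geodesic ray \<open>x\<^sub>0, x\<^sub>1, \<dots>\<close> and let \<open>f\<close> be the distance from \<open>x\<^sub>0\<close>: the integers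
  \<open>\<Delta>f(x\<^sub>n)\<close> are non-increasing, hence eventually constant, and this makes the neighbours off the ray
  form the second side of a half-infinite ladder.  All vertices of a half-infinite ladder except the
  two at its end are saturated; either it extends backwards for ever, or the curvature condition
  leaves only seven shapes for its end.
\<close>

text \<open>Since \<open>curvature\<close> is a \<open>Lim\<close>, it carries no information until
  convergence is known. With W the transport cost between the two lazy measures on an edge,
  convexity of W in \<epsilon> makes (1 - W) / \<epsilon> monotone, and duality bounds it. Besides
  the distance from the origin, the test functions are minima of shifted distances from the two
  other neighbours of a vertex of degree 3. They give \<open>curvature_3_2\<close> and
  \<open>curvature_3_3\<close>; the rest is the combinatorics of distances up to 3. The delicate
  value of the eventual Laplacian is 0: it is also the value at a ray vertex of degree 2, so such
  vertices have to be excluded by a separate argument. Isomorphisms are built from the model into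
  \<open>G\<close>. A map that carries whole neighbourhoods to whole neighbourhoods is onto by
  connectedness, so saturation of vertices does most of the work.\<close>

section \<open>Sequences and one-sided limits\<close>

text \<open>Prepending terms for ever yields a two-sided sequence all of whose tails, starting at
  any index -k, have the property. Facts about \<open>Z\<close> near an integer are then read off in
  a tail that begins early enough. It serves both lines and, through sequences of pairs,
  ladders.\<close>

lemma extend_to_int:
  fixes P :: "(nat \<Rightarrow> 'a) \<Rightarrow> bool"
  assumes "P X\<^sub>0" and ext: "\<And>X. P X \<Longrightarrow> \<exists>x. P (case_nat x X)"
  obtains Z :: "int \<Rightarrow> 'a" where "\<And>k :: nat. P (\<lambda>i. Z (int i - int k))"
proof -
  have "\<exists>S. \<forall>k. P (S k) \<and> (\<exists>x. S (Suc k) = case_nat x (S k))"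
    by (rule dependent_nat_choice) (use assms in auto)
  then obtain S where S: "\<And>k. P (S k)" "\<And>k. \<exists>x. S (Suc k) = case_nat x (S k)" by blast
  have "S (Suc k) (Suc i) = S k i" for k i using S(2)[of k] by auto
  \<comment> \<open>Place i of \<open>S k\<close> stands for the integer i - k; further prolongation
    does not change the entry at a given integer.\<close>
  then have shift: "S (k + m) (i + m) = S k i" for k i m by (induction m) auto
  define Z where "Z j = (if j < 0 then S (nat (- j)) 0 else S 0 (nat j))" for j
  have "Z (int i - int k) = S k i" for i k
  proof (cases "i < k")
    case True
    then show ?thesis using shift[of "k - i" i 0] by (simp add: Z_def nat_diff_distrib')
  next
    case False
    then show ?thesis using shift[of 0 k "i - k"] by (simp add: Z_def nat_diff_distrib')
  qed
  then have "P (\<lambda>i. Z (int i - int k))" for k using S(1)[of k] by presburger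
  then show thesis using that by blast
qed

text \<open>Monotone convergence towards 0 from the right: the limit is the supremum. This is what
  turns the \<open>Lim\<close> in \<open>curvature\<close> into an actual limit.\<close>

lemma tendsto_at_right_antimono_on:
  fixes h :: "real \<Rightarrow> real"
  assumes "0 < e" and mono: "\<And>s t. 0 < s \<Longrightarrow> s \<le> t \<Longrightarrow> t \<le> e \<Longrightarrow> h t \<le> h s"
    and bdd: "\<And>t. 0 < t \<Longrightarrow> t \<le> e \<Longrightarrow> h t \<le> B"
  shows "\<exists>L \<le> B. (h \<longlongrightarrow> L) (at_right 0)"
proof (intro exI conjI)
  let ?L = "SUP t\<in>{0<..e}. h t"
  have ne: "{0<..e} \<noteq> {}" using \<open>0 < e\<close> by auto
  show "?L \<le> B" using ne bdd by (auto intro: cSUP_least)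
  have "bdd_above (h ` {0<..e})" using bdd by (auto intro!: bdd_aboveI[of _ B])
  then have up: "h t \<le> ?L" if "0 < t" "t \<le> e" for t using that by (auto intro: cSUP_upper)
  show "(h \<longlongrightarrow> ?L) (at_right 0)"
  proof (rule order_tendstoI)
    fix a assume "a < ?L"
    then obtain t where t: "0 < t" "t \<le> e" "a < h t"
      using less_cSUP_iff[OF ne \<open>bdd_above (h ` {0<..e})\<close>] by auto
    then show "\<forall>\<^sub>F x in at_right 0. a < h x"
      unfolding eventually_at_right_field
      by (intro exI[of _ t]) (auto intro: less_le_trans[OF _ mono])
  next
    fix a assume "?L < a"
    then show "\<forall>\<^sub>F x in at_right 0. h x < a"
      unfolding eventually_at_right_field using \<open>0 < e\<close>
      by (intro exI[of _ e]) (auto intro: le_less_trans[OF up])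
  qed
qed

text \<open>The sequence is constant once it attains its least value. The first term is exempt from
  \<open>F\<close> because the Laplacian of the distance from an origin of degree 3 is 3 at the
  origin itself.\<close>

lemma antimono_finite_range_eventually_constant:
  fixes c :: "nat \<Rightarrow> real"
  assumes anti: "\<And>n. c (Suc n) \<le> c n" and fin: "finite F" "\<And>n. c (Suc n) \<in> F"
  obtains N where "\<And>n. n \<ge> N \<Longrightarrow> c n = c N"
proof -
  let ?R = "c ` {1..}"
  have "c n \<in> F" if "n \<ge> 1" for n using fin(2)[of "n - 1"] that by simp
  then have R: "finite ?R" using fin(1) by (meson finite_subset image_subsetI atLeast_iff)
  moreover have "?R \<noteq> {}" by auto
  ultimately have "Min ?R \<in> ?R" by (rule Min_in)
  then obtain N where N: "N \<ge> 1" "c N = Min ?R" by auto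
  have "c n = c N" if "n \<ge> N" for n
  proof (rule antisym)
    show "c n \<le> c N" using that anti lift_Suc_antimono_le[of c N n] by blast
    show "c N \<le> c n" using N R that by simp
  qed
  then show thesis using that by blast
qed

lemma mem_sym_closure: "(p, q) \<in> sym_closure R \<longleftrightarrow> (p, q) \<in> R \<or> (q, p) \<in> R"
  by (auto simp: sym_closure_def)

subsection \<open>Distances, Lipschitz functions and curvature\<close>

locale lf_graph =
  fixes G :: "'v ugraph"
  assumes simple: "simple_graph G"
    and connected: "graph_connected G"
    and loc_fin: "locally_finite G"
begin

abbreviation edge :: "'v \<Rightarrow> 'v \<Rightarrow> bool" (infix "\<leftrightarrow>" 50) where
  "u \<leftrightarrow> v \<equiv> (u, v) \<in> adj G"

lemma edge_sym: "u \<leftrightarrow> v \<Longrightarrow> v \<leftrightarrow> u"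
  using simple by (auto simp: simple_graph_def dest: symD)

lemma edge_commute: "u \<leftrightarrow> v \<longleftrightarrow> v \<leftrightarrow> u"
  using edge_sym by blast

lemma not_edge_self [simp]: "\<not> u \<leftrightarrow> u"
  using simple by (auto simp: simple_graph_def irrefl_def)

lemma edge_verts: "u \<leftrightarrow> v \<Longrightarrow> u \<in> verts G \<and> v \<in> verts G"
  using simple by (auto simp: simple_graph_def)

lemma mem_nbrs [simp]: "v \<in> nbrs G u \<longleftrightarrow> u \<leftrightarrow> v"
  by (simp add: nbrs_def)

lemma edge_in_nbrs: "u \<leftrightarrow> v \<Longrightarrow> nbrs G u = S \<Longrightarrow> v \<in> S"
  by auto

lemma nbrs_subset: "nbrs G u \<subseteq> verts G"
  using edge_verts by auto

lemma finite_nbrs [simp]: "finite (nbrs G u)"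
proof (cases "u \<in> verts G")
  case True
  then show ?thesis using loc_fin by (simp add: locally_finite_def)
next
  case False
  then have "nbrs G u = {}" using edge_verts by (auto simp: nbrs_def)
  then show ?thesis by simp
qed

lemma walk_gdist:
  assumes "u \<in> verts G" "v \<in> verts G"
  shows "(u, v) \<in> adj G ^^ gdist G u v"
proof -
  have "(u, v) \<in> (adj G)\<^sup>*" using connected assms by (auto simp: graph_connected_def)
  then show ?thesis
    unfolding gdist_def by (metis (mono_tags, lifting) LeastI rtrancl_imp_relpow)
qed

lemma gdist_le: "(u, v) \<in> adj G ^^ n \<Longrightarrow> gdist G u v \<le> n"
  unfolding gdist_def by (rule Least_le)

lemma gdist_self [simp]: "gdist G u u = 0"
  using gdist_le[of u u 0] by simp

lemma gdist_eq_0: "u \<in> verts G \<Longrightarrow> v \<in> verts G \<Longrightarrow> gdist G u v = 0 \<longleftrightarrow> u = v"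
  using walk_gdist[of u v] by auto

lemma gdist_step:
  assumes "u \<in> verts G" "v \<leftrightarrow> w"
  shows "gdist G u w \<le> gdist G u v + 1"
  using walk_gdist[of u v] assms edge_verts[of v w] gdist_le[of u w "Suc (gdist G u v)"] by auto

lemma gdist_edge:
  assumes "u \<leftrightarrow> v"
  shows "gdist G u v = 1"
proof -
  have "u \<in> verts G" "v \<in> verts G" "u \<noteq> v" using assms edge_verts by auto
  then show ?thesis
    using gdist_eq_0[of u v] gdist_step[of u u v] assms by simp
qed

lemma gdist_SucE:
  assumes "u \<in> verts G" "v \<in> verts G" "gdist G u v = Suc n"
  obtains w where "u \<leftrightarrow> w" "gdist G w v = n"
proof -
  obtain w where w: "u \<leftrightarrow> w" "(w, v) \<in> adj G ^^ n"
    using walk_gdist[OF assms(1,2)] assms(3) by (metis relpow_Suc_E2)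
  have "(u, v) \<in> adj G ^^ Suc (gdist G w v)"
    using w(1) walk_gdist[of w v] assms(2) edge_verts by (meson relpow_Suc_I2)
  then have "Suc n \<le> Suc (gdist G w v)" using gdist_le assms(3) by metis
  then show thesis using that w gdist_le[OF w(2)] by (metis Suc_le_mono le_antisym)
qed

lemma gdist_le_1D:
  assumes "u \<in> verts G" "v \<in> verts G" "gdist G u v \<le> 1"
  shows "u = v \<or> u \<leftrightarrow> v"
proof -
  consider "gdist G u v = 0" | "gdist G u v = 1" using assms(3) by linarith
  then show ?thesis
    using walk_gdist[OF assms(1,2)] by cases auto
qed

lemma gdist_le_2D:
  assumes "u \<in> verts G" "v \<in> verts G" "gdist G u v \<le> 2"
  shows "u = v \<or> u \<leftrightarrow> v \<or> (\<exists>w. u \<leftrightarrow> w \<and> w \<leftrightarrow> v)"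
proof (cases "gdist G u v = 2")
  case True
  then obtain w where "u \<leftrightarrow> w" "gdist G w v = 1"
    using gdist_SucE[OF assms(1,2), of 1] by auto
  then show ?thesis
    using gdist_le_1D[of w v] assms(2) edge_verts by auto
next
  case False
  then show ?thesis using gdist_le_1D[OF assms(1,2)] assms(3) by auto
qed

text \<open>Imposed on edges only and in one direction: symmetry of adjacency supplies the other,
  and \<open>lipschitz_gdist\<close> the bound for arbitrary pairs.\<close>

definition lipschitz :: "('v \<Rightarrow> real) \<Rightarrow> bool" where
  "lipschitz f \<longleftrightarrow> (\<forall>v w. v \<leftrightarrow> w \<longrightarrow> f w \<le> f v + 1)"

lemma lipschitz_gdist:
  assumes "lipschitz f" "u \<in> verts G" "v \<in> verts G"
  shows "f v - f u \<le> gdist G u v"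
  using assms(2,3)
proof (induction "gdist G u v" arbitrary: u)
  case 0
  then show ?case using gdist_eq_0 by fastforce
next
  case (Suc n)
  then obtain w where w: "u \<leftrightarrow> w" "gdist G w v = n"
    by (metis gdist_SucE)
  then have "f v - f w \<le> n" "f w \<le> f u + 1"
    using Suc.hyps(1)[of w] Suc.prems edge_verts assms(1) by (auto simp: lipschitz_def)
  then show ?case using Suc.hyps(2) by linarith
qed

definition laplace :: "('v \<Rightarrow> real) \<Rightarrow> 'v \<Rightarrow> real" where
  "laplace f u = (\<Sum>w\<in>nbrs G u. f w - f u)"

section \<open>Lazy measures, couplings and transport costs\<close>

lemma lazy_measure_support:
  "w \<notin> insert u (nbrs G u) \<Longrightarrow> lazy_measure G \<epsilon> u w = 0"
  by (auto simp: lazy_measure_def)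

text \<open>The Laplacian enters here, as the first-order term in \<epsilon> of the integral of
  \<open>f\<close>.\<close>

lemma sum_lazy_measure:
  "(\<Sum>w\<in>insert u (nbrs G u). f w * lazy_measure G \<epsilon> u w) = f u + \<epsilon> * laplace f u"
proof -
  have "(\<Sum>w\<in>nbrs G u. f w * lazy_measure G \<epsilon> u w) = (\<Sum>w\<in>nbrs G u. \<epsilon> * f w)"
    by (rule sum.cong) (auto simp: lazy_measure_def)
  then show ?thesis
    by (simp add: lazy_measure_def laplace_def vdeg_def sum_subtractf sum_distrib_left algebra_simps)
qed

lemma lazy_measure_bounds:
  assumes "0 \<le> \<epsilon>" "\<epsilon> * real (vdeg G u) \<le> 1" "\<epsilon> \<le> 1"
  shows "lazy_measure G \<epsilon> u w \<in> {0..1}"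
  using assms by (auto simp: lazy_measure_def)

lemma has_sum_finite_superset:
  fixes g :: "'a \<Rightarrow> real"
  assumes "finite S" "S \<subseteq> B" "\<And>x. x \<in> B - S \<Longrightarrow> g x = 0"
  shows "(g has_sum c) B \<longleftrightarrow> c = sum g S"
proof -
  have "(g has_sum c) B \<longleftrightarrow> (g has_sum c) S"
    by (rule has_sum_cong_neutral) (use assms in auto)
  also have "\<dots> \<longleftrightarrow> c = sum g S"
    using has_sum_finite[OF assms(1), of g] has_sum_unique by blast
  finally show ?thesis .
qed

lemma coupling_zero:
  assumes A: "is_coupling G \<mu> \<nu> A" and "p \<in> verts G" "q \<in> verts G" and "\<mu> p = 0 \<or> \<nu> q = 0"
  shows "A p q = 0"
  using assms(4)
proof
  assume "\<mu> p = 0"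
  then have "((\<lambda>q. A p q) has_sum 0) (verts G)" using A assms by (auto simp: is_coupling_def)
  then show ?thesis
    using nonneg_has_sum_le_0D[where f = "\<lambda>q. A p q" and a = 0 and A = "verts G" and x = q] A assms
    by (auto simp: is_coupling_def)
next
  assume "\<nu> q = 0"
  then have "((\<lambda>p. A p q) has_sum 0) (verts G)" using A assms by (auto simp: is_coupling_def)
  then show ?thesis
    using nonneg_has_sum_le_0D[where f = "\<lambda>p. A p q" and a = 0 and A = "verts G" and x = p] A assms
    by (auto simp: is_coupling_def)
qed

lemma transport_cost_ge:
  assumes A: "is_coupling G \<mu> \<nu> A"
    and cost: "((\<lambda>(p, q). A p q * real (gdist G p q)) has_sum c) (verts G \<times> verts G)"
    and S: "finite S" "S \<subseteq> verts G" "\<And>p. p \<notin> S \<Longrightarrow> \<mu> p = 0"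
    and T: "finite T" "T \<subseteq> verts G" "\<And>q. q \<notin> T \<Longrightarrow> \<nu> q = 0"
    and f: "lipschitz f"
  shows "(\<Sum>q\<in>T. f q * \<nu> q) - (\<Sum>p\<in>S. f p * \<mu> p) \<le> c"
proof -
  note zero = coupling_zero[OF A]
  have row: "\<mu> p = (\<Sum>q\<in>T. A p q)" if "p \<in> S" for p
    using A that S T has_sum_finite_superset[of T "verts G" "\<lambda>q. A p q" "\<mu> p"] zero
    by (auto simp: is_coupling_def)
  have col: "\<nu> q = (\<Sum>p\<in>S. A p q)" if "q \<in> T" for q
    using A that S T has_sum_finite_superset[of S "verts G" "\<lambda>p. A p q" "\<nu> q"] zero
    by (auto simp: is_coupling_def)
  have "c = (\<Sum>(p, q)\<in>S \<times> T. A p q * real (gdist G p q))"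
  proof -
    have "A p q = 0" if "p \<in> verts G" "q \<in> verts G" "p \<notin> S \<or> q \<notin> T" for p q
      using that zero S(3) T(3) by blast
    then have "((\<lambda>(p, q). A p q * real (gdist G p q)) has_sum c) (verts G \<times> verts G) \<longleftrightarrow> ?thesis"
      using S(1,2) T(1,2) by (intro has_sum_finite_superset) fastforce+
    then show ?thesis using cost by simp
  qed
  also have "\<dots> = (\<Sum>p\<in>S. \<Sum>q\<in>T. A p q * real (gdist G p q))"
    by (simp add: sum.cartesian_product)
  \<comment> \<open>Weak duality: the distance dominates the increment of \<open>f\<close>, and the
    marginals then separate the two variables.\<close>
  also have "\<dots> \<ge> (\<Sum>p\<in>S. \<Sum>q\<in>T. A p q * (f q - f p))"
    using A S(2) T(2) lipschitz_gdist[OF f]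
    by (intro sum_mono mult_left_mono) (auto simp: is_coupling_def subset_eq)
  also have "(\<Sum>p\<in>S. \<Sum>q\<in>T. A p q * (f q - f p)) =
      (\<Sum>q\<in>T. \<Sum>p\<in>S. f q * A p q) - (\<Sum>p\<in>S. \<Sum>q\<in>T. f p * A p q)"
    unfolding sum.swap[of "\<lambda>q p. f q * A p q" S T] by (simp add: sum_subtractf algebra_simps)
  also have "\<dots> = (\<Sum>q\<in>T. f q * \<nu> q) - (\<Sum>p\<in>S. f p * \<mu> p)"
    by (simp add: row col sum_distrib_left)
  finally show ?thesis by simp
qed

abbreviation costs :: "real \<Rightarrow> 'v \<Rightarrow> 'v \<Rightarrow> real set" where
  "costs \<epsilon> u v \<equiv> {c. \<exists>A. is_coupling G (lazy_measure G \<epsilon> u) (lazy_measure G \<epsilon> v) A \<and>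
     ((\<lambda>(u, v). A u v * real (gdist G u v)) has_sum c) (verts G \<times> verts G)}"

lemma costs_ge:
  assumes "u \<in> verts G" "v \<in> verts G" "lipschitz f" "c \<in> costs \<epsilon> u v"
  shows "f v - f u + \<epsilon> * (laplace f v - laplace f u) \<le> c"
proof -
  obtain A where A: "is_coupling G (lazy_measure G \<epsilon> u) (lazy_measure G \<epsilon> v) A"
    "((\<lambda>(u, v). A u v * real (gdist G u v)) has_sum c) (verts G \<times> verts G)"
    using assms by auto
  show ?thesis
    using transport_cost_ge[OF A, of "insert u (nbrs G u)" "insert v (nbrs G v)" f]
      assms nbrs_subset lazy_measure_support
    unfolding sum_lazy_measure by (fastforce simp: algebra_simps)
qed

text \<open>The product coupling has finite support, hence finite cost. Nonemptiness matters because
  the real \<open>Inf\<close> of the empty set is meaningless.\<close>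

lemma costs_nonempty:
  assumes uv: "u \<in> verts G" "v \<in> verts G" and e: "0 \<le> \<epsilon>" "\<epsilon> \<le> 1"
    "\<epsilon> * real (vdeg G u) \<le> 1" "\<epsilon> * real (vdeg G v) \<le> 1"
  shows "costs \<epsilon> u v \<noteq> {}"
proof -
  let ?m = "lazy_measure G \<epsilon>"
  let ?N = "\<lambda>u. insert u (nbrs G u)"
  define A where "A = (\<lambda>p q. ?m u p * ?m v q)"
  have N: "finite (?N w)" "w \<in> verts G \<Longrightarrow> ?N w \<subseteq> verts G" for w using nbrs_subset by auto
  have tot: "(\<Sum>p\<in>?N w. ?m w p) = 1" for w
    using sum_lazy_measure[of "\<lambda>_. 1" \<epsilon> w] by (simp add: laplace_def)
  have "is_coupling G (?m u) (?m v) A"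
    unfolding is_coupling_def
  proof (intro conjI ballI)
    fix p q
    show "A p q \<in> {0..1}"
      using lazy_measure_bounds[of \<epsilon> u p] lazy_measure_bounds[of \<epsilon> v q] e
      by (auto simp: A_def intro: mult_le_one)
    have "(A p has_sum ?m u p) (verts G) \<longleftrightarrow> ?m u p = sum (A p) (?N v)"
      by (rule has_sum_finite_superset) (use N uv lazy_measure_support in \<open>auto simp: A_def\<close>)
    then show "(A p has_sum ?m u p) (verts G)"
      using tot[of v] by (simp add: A_def flip: sum_distrib_left)
    have "((\<lambda>p. A p q) has_sum ?m v q) (verts G) \<longleftrightarrow> ?m v q = sum (\<lambda>p. A p q) (?N u)"
      by (rule has_sum_finite_superset) (use N uv lazy_measure_support in \<open>auto simp: A_def\<close>)
    then show "((\<lambda>p. A p q) has_sum ?m v q) (verts G)"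
      using tot[of u] by (simp add: A_def flip: sum_distrib_right)
  qed
  moreover have "((\<lambda>(p, q). A p q * real (gdist G p q)) has_sum
      (\<Sum>(p, q)\<in>?N u \<times> ?N v. A p q * real (gdist G p q))) (verts G \<times> verts G)"
    by (subst has_sum_finite_superset[of "?N u \<times> ?N v"])
      (use N uv in \<open>auto simp: A_def lazy_measure_def split: if_splits\<close>)
  ultimately show ?thesis by blast
qed

lemma lazy_measure_scale:
  "lazy_measure G (t * \<epsilon>) u w = t * lazy_measure G \<epsilon> u w + (1 - t) * (if w = u then 1 else 0)"
  by (simp add: lazy_measure_def algebra_simps)

text \<open>For \<open>\<epsilon> = 0\<close> the only coupling is the point mass at \<open>(u, v)\<close>; mixing a coupling with it
  shows that the cost is a convex function of \<open>\<epsilon>\<close>.\<close>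

lemma costs_scale:
  assumes uv: "u \<in> verts G" "v \<in> verts G" and t: "0 \<le> t" "t \<le> 1" and c: "c \<in> costs \<epsilon> u v"
  shows "t * c + (1 - t) * gdist G u v \<in> costs (t * \<epsilon>) u v"
proof -
  obtain A where A: "is_coupling G (lazy_measure G \<epsilon> u) (lazy_measure G \<epsilon> v) A"
    "((\<lambda>(u, v). A u v * real (gdist G u v)) has_sum c) (verts G \<times> verts G)"
    using c by auto
  define D where "D = (\<lambda>p q. if p = u \<and> q = v then 1 else 0 :: real)"
  define B where "B = (\<lambda>p q. t * A p q + (1 - t) * D p q)"
  have row: "(D p has_sum (if p = u then 1 else 0)) (verts G)" for p
    by (subst has_sum_finite_superset[of "{v}"]) (use uv in \<open>auto simp: D_def\<close>)
  have col: "((\<lambda>p. D p q) has_sum (if q = v then 1 else 0)) (verts G)" for q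
    by (subst has_sum_finite_superset[of "{u}"]) (use uv in \<open>auto simp: D_def\<close>)
  have "((\<lambda>(p, q). D p q * real (gdist G p q)) has_sum gdist G u v) (verts G \<times> verts G)"
    by (subst has_sum_finite_superset[of "{(u, v)}"]) (use uv in \<open>auto simp: D_def split: if_splits\<close>)
  from has_sum_add[OF has_sum_cmult_right[OF A(2), of t] has_sum_cmult_right[OF this, of "1 - t"]]
  have "((\<lambda>(p, q). B p q * real (gdist G p q)) has_sum (t * c + (1 - t) * gdist G u v))
      (verts G \<times> verts G)"
    by (simp add: B_def case_prod_unfold algebra_simps)
  moreover have "is_coupling G (lazy_measure G (t * \<epsilon>) u) (lazy_measure G (t * \<epsilon>) v) B"
    unfolding is_coupling_def lazy_measure_scale
  proof (intro conjI ballI)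
    fix p q assume p: "p \<in> verts G" and q: "q \<in> verts G"
    have "A p q \<in> {0..1}" "D p q \<in> {0..1}" using A p q by (auto simp: is_coupling_def D_def)
    then show "B p q \<in> {0..1}"
      using t convex_bound_le[of "A p q" 1 "D p q" t "1 - t"] by (auto simp: B_def)
    show "(B p has_sum t * lazy_measure G \<epsilon> u p + (1 - t) * (if p = u then 1 else 0)) (verts G)"
      unfolding B_def using A(1) p row by (intro has_sum_add has_sum_cmult_right) (auto simp: is_coupling_def)
    show "((\<lambda>p. B p q) has_sum t * lazy_measure G \<epsilon> v q + (1 - t) * (if q = v then 1 else 0)) (verts G)"
      unfolding B_def using A(1) q col by (intro has_sum_add has_sum_cmult_right) (auto simp: is_coupling_def)
  qed
  ultimately show ?thesis by blast
qed

text \<open>Weak duality bounds the difference quotient by the right-hand side for every small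
  \<epsilon>, and \<open>costs_scale\<close> makes it antitone in \<epsilon>. Hence the limit exists
  and inherits the bound.\<close>

lemma curvature_le:
  assumes uv: "u \<leftrightarrow> v" and f: "lipschitz f" "f v = f u + 1"
  shows "curvature G u v \<le> laplace f u - laplace f v"
proof -
  note verts = edge_verts[OF uv]
  have d: "gdist G u v = 1" using gdist_edge[OF uv] .
  \<comment> \<open>Small enough that both lazy measures take values in [0, 1] for all \<epsilon> up
    to \<open>e\<close>.\<close>
  define e where "e = 1 / (1 + real (vdeg G u) + real (vdeg G v))"
  have e: "0 < e" "e \<le> 1" "e * real (vdeg G u) \<le> 1" "e * real (vdeg G v) \<le> 1"
    by (auto simp: e_def field_simps)
  let ?W = "\<lambda>\<epsilon>. Inf (costs \<epsilon> u v)"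
  have ge: "1 + \<epsilon> * (laplace f v - laplace f u) \<le> c" if "c \<in> costs \<epsilon> u v" for c \<epsilon>
    using costs_ge[OF _ _ f(1) that] verts f(2) by simp
  have bdd: "bdd_below (costs \<epsilon> u v)" for \<epsilon> using ge by (rule bdd_belowI)
  have ne: "costs \<epsilon> u v \<noteq> {}" if "0 < \<epsilon>" "\<epsilon> \<le> e" for \<epsilon>
  proof (rule costs_nonempty)
    have "\<epsilon> * real (vdeg G w) \<le> e * real (vdeg G w)" for w
      using that by (simp add: mult_right_mono)
    then show "\<epsilon> * real (vdeg G u) \<le> 1" "\<epsilon> * real (vdeg G v) \<le> 1" using e order_trans by blast+
  qed (use verts e that in auto)
  define h where "h = (\<lambda>\<epsilon>. 1 / \<epsilon> * kappa_eps G \<epsilon> u v)"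
  have h: "h \<epsilon> = (1 - ?W \<epsilon>) / \<epsilon>" for \<epsilon>
    by (simp add: h_def kappa_eps_def wasserstein_def d)
  have "\<exists>L \<le> laplace f u - laplace f v. (h \<longlongrightarrow> L) (at_right 0)"
  proof (rule tendsto_at_right_antimono_on)
    show "0 < e" by fact
  next
    fix t assume t: "0 < t" "t \<le> e"
    have "1 + t * (laplace f v - laplace f u) \<le> ?W t"
      by (rule cInf_greatest[OF ne[OF t] ge])
    then show "h t \<le> laplace f u - laplace f v"
      using t by (simp add: h field_simps)
  next
    fix s t assume st: "0 < s" "s \<le> t" "t \<le> e"
    \<comment> \<open>The ratio shrinks a coupling for \<open>t\<close> to one for \<open>s\<close>.
      As the edge has length 1, W(s) is at most \<theta> W(t) + 1 - \<theta>.\<close>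
    define \<theta> where "\<theta> = s / t"
    have \<theta>: "0 < \<theta>" "\<theta> \<le> 1" "\<theta> * t = s" using st by (auto simp: \<theta>_def)
    have "(?W s - (1 - \<theta>)) / \<theta> \<le> c" if "c \<in> costs t u v" for c
    proof -
      have "\<theta> * c + (1 - \<theta>) \<in> costs s u v"
        using costs_scale[OF _ _ _ _ that, of \<theta>] verts \<theta> d by simp
      then have "?W s \<le> \<theta> * c + (1 - \<theta>)" using bdd by (rule cInf_lower)
      then show ?thesis using \<theta> by (simp add: field_simps)
    qed
    then have "(?W s - (1 - \<theta>)) / \<theta> \<le> ?W t"
      using ne st by (intro cInf_greatest) auto
    then have "\<theta> * (1 - ?W t) \<le> 1 - ?W s" using \<theta> by (simp add: field_simps)
    then show "h t \<le> h s" using st by (simp add: h \<theta>_def field_simps)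
  qed
  then obtain L where L: "L \<le> laplace f u - laplace f v" "(h \<longlongrightarrow> L) (at_right 0)" by blast
  have "curvature G u v = L"
    unfolding curvature_def using L(2) by (intro tendsto_Lim) (auto simp: h_def)
  then show ?thesis using L(1) by simp
qed

lemma gdist_triangle:
  assumes "u \<in> verts G" "v \<in> verts G" "w \<in> verts G"
  shows "gdist G u w \<le> gdist G u v + gdist G v w"
  using relpow_trans[OF walk_gdist walk_gdist] assms gdist_le by blast

lemma gdist_sym:
  assumes "u \<in> verts G" "v \<in> verts G"
  shows "gdist G u v = gdist G v u"
proof -
  have "(u, v) \<in> adj G ^^ n \<Longrightarrow> (v, u) \<in> adj G ^^ n" for u v n
    by (induction n arbitrary: v) (auto simp del: relpow.simps(2) intro: relpow_Suc_I2 edge_sym elim!: relpow_Suc_E)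
  then have "gdist G v u \<le> gdist G u v" if "u \<in> verts G" "v \<in> verts G" for u v
    using walk_gdist[OF that] gdist_le by blast
  then show ?thesis using assms by (simp add: le_antisym)
qed

lemma lipschitz_gdist_from: "u \<in> verts G \<Longrightarrow> lipschitz (\<lambda>w. real (gdist G u w))"
  using gdist_step by (fastforce simp: lipschitz_def)

text \<open>Koenig's lemma on the vertices beyond v: \<open>D v\<close> collects those reached from
  \<open>x\<^sub>0\<close> by a geodesic through v. It is covered by v and the sets
  \<open>D w\<close> of the finitely many outward neighbours w, so infinity passes on to one of
  them.\<close>

lemma geodesic_ray:
  assumes "infinite (verts G)" "x\<^sub>0 \<in> verts G"
  obtains x where "x 0 = x\<^sub>0" "\<And>n. x n \<leftrightarrow> x (Suc n)" "\<And>n. gdist G x\<^sub>0 (x n) = n"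
proof -
  define D where "D v = {w \<in> verts G. gdist G x\<^sub>0 w = gdist G x\<^sub>0 v + gdist G v w}" for v
  define P where "P n v \<longleftrightarrow> v \<in> verts G \<and> gdist G x\<^sub>0 v = n \<and> infinite (D v) \<and> (n = 0 \<longrightarrow> v = x\<^sub>0)"
    for n v
  have "\<exists>x. \<forall>n. P n (x n) \<and> x n \<leftrightarrow> x (Suc n)"
  proof (rule dependent_nat_choice)
    have "D x\<^sub>0 = verts G" by (auto simp: D_def)
    then show "\<exists>v. P 0 v" using assms by (auto simp: P_def)
  next
    fix v n assume v: "P n v"
    let ?S = "{w \<in> nbrs G v. gdist G x\<^sub>0 w = Suc n}"
    have "D v \<subseteq> insert v (\<Union>w\<in>?S. D w)"
    proof
      fix z assume z: "z \<in> D v"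
      show "z \<in> insert v (\<Union>w\<in>?S. D w)"
      proof (cases "gdist G v z")
        case 0
        then show ?thesis using z v gdist_eq_0 by (auto simp: D_def P_def)
      next
        case (Suc m)
        then obtain w where w: "v \<leftrightarrow> w" "gdist G w z = m"
          using gdist_SucE[of v z m] z v by (auto simp: D_def P_def)
        then have "gdist G x\<^sub>0 w \<le> Suc n" "gdist G x\<^sub>0 z \<le> gdist G x\<^sub>0 w + m"
          using gdist_step[of x\<^sub>0 v w] gdist_triangle[of x\<^sub>0 w z] assms v z edge_verts
          by (auto simp: D_def P_def)
        then have "w \<in> ?S" "z \<in> D w" using w z v Suc by (auto simp: D_def P_def)
        then show ?thesis by blast
      qed
    qed
    moreover have "infinite (D v)" using v by (simp add: P_def)
    ultimately have "infinite (\<Union>w\<in>?S. D w)" by (meson finite_insert finite_subset)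
    moreover have "finite ?S" using finite_nbrs[of v] by (rule rev_finite_subset) blast
    ultimately obtain w where "w \<in> ?S" "infinite (D w)" by blast
    then show "\<exists>w. P (Suc n) w \<and> v \<leftrightarrow> w" using edge_verts by (auto simp: P_def)
  qed
  then show thesis using that by (auto simp: P_def)
qed

subsection \<open>Graphs of maximum degree two\<close>

text \<open>The image of \<open>f\<close> is closed under adjacency, so connectedness makes it all
  of \<open>G\<close>. The map goes from the model to \<open>G\<close> because neighbourhoods are
  known at the named vertices; its inverse is the isomorphism sought.\<close>

lemma graph_isoI:
  assumes inj: "inj_on f (verts H)" and "verts H \<noteq> {}" "adj H \<subseteq> verts H \<times> verts H"
    and "f ` verts H \<subseteq> verts G"
    and nbrs: "\<And>h. h \<in> verts H \<Longrightarrow> nbrs G (f h) = f ` nbrs H h"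
  shows "G \<simeq>\<^sub>G H"
proof -
  have "v \<in> f ` verts H" if "v \<in> verts G" for v
  proof -
    obtain h where h: "h \<in> verts H" using assms by blast
    then have "(f h, v) \<in> (adj G)\<^sup>*"
      using connected that assms by (auto simp: graph_connected_def)
    then show ?thesis
    proof (induction rule: rtrancl_induct)
      case base
      then show ?case using h by blast
    next
      case (step v w)
      then obtain h' where "h' \<in> verts H" "v = f h'" by blast
      then have "w \<in> f ` nbrs H h'" using step nbrs[of h'] by auto
      then show ?case using assms(3) by (auto simp: nbrs_def)
    qed
  qed
  then have img: "f ` verts H = verts G" using assms(4) by auto
  then have bij: "bij_betw f (verts H) (verts G)" using inj by (simp add: bij_betw_def)
  have "f h \<leftrightarrow> f h' \<longleftrightarrow> (h, h') \<in> adj H" if "h \<in> verts H" "h' \<in> verts H" for h h'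
  proof -
    have "f h \<leftrightarrow> f h' \<longleftrightarrow> f h' \<in> f ` nbrs H h" using nbrs[OF that(1)] by auto
    also have "\<dots> \<longleftrightarrow> h' \<in> nbrs H h"
      using that assms(3) inj by (intro inj_on_image_mem_iff[of f "verts H"]) (auto simp: nbrs_def)
    finally show ?thesis by (simp add: nbrs_def)
  qed
  then have "u \<leftrightarrow> v \<longleftrightarrow> (inv_into (verts H) f u, inv_into (verts H) f v) \<in> adj H"
    if "u \<in> verts G" "v \<in> verts G" for u v
    using that img inv_into_into[of u f "verts H"] inv_into_into[of v f "verts H"]
      f_inv_into_f[of u f "verts H"] f_inv_into_f[of v f "verts H"] by metis
  then show ?thesis
    unfolding graph_iso_def using bij_betw_inv_into[OF bij] by blast
qed

definition half_line :: "(nat \<Rightarrow> 'v) \<Rightarrow> bool" where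
  "half_line X \<longleftrightarrow> inj X \<and> (\<forall>n. X n \<leftrightarrow> X (Suc n))"

text \<open>Beyond its first vertex a half line is saturated by the degree bound 2. If every half
  line can be prolonged, a two-sided line results; otherwise one that cannot be prolonged ends in a
  vertex of degree 1.\<close>

lemma line_cases:
  assumes inf: "infinite (verts G)" and deg: "\<And>u. u \<in> verts G \<Longrightarrow> vdeg G u \<le> 2"
  shows "G \<simeq>\<^sub>G both_side_line \<or> G \<simeq>\<^sub>G one_side_line"
proof -
  have nbrs2: "nbrs G u = {a, b}" if "u \<leftrightarrow> a" "u \<leftrightarrow> b" "a \<noteq> b" for u a b
    using that deg[of u] edge_verts[of u a]
    by (intro card_seteq[symmetric]) (auto simp: vdeg_def)
  obtain u where "u \<in> verts G" using inf infinite_imp_nonempty by blast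
  then obtain x where x: "\<And>n. x n \<leftrightarrow> x (Suc n)" "\<And>n. gdist G u (x n) = n"
    using geodesic_ray[OF inf] by blast
  have "half_line x" unfolding half_line_def inj_def using x by metis
  have interior: "nbrs G (X (Suc n)) = {X n, X (n + 2)}" if X: "half_line X" for X n
    using X edge_sym by (intro nbrs2) (auto simp: half_line_def inj_eq)
  show ?thesis
  proof (cases "\<forall>X. half_line X \<longrightarrow> (\<exists>x. half_line (case_nat x X))")
    case True
    then obtain Z :: "int \<Rightarrow> 'v" where Z: "\<And>k. half_line (\<lambda>i. Z (int i - int k))"
      using extend_to_int[of half_line x] \<open>half_line x\<close> by blast
    have nb: "nbrs G (Z j) = {Z (j - 1), Z (j + 1)}" for j
    proof -
      \<comment> \<open>The tail starts at or before j - 1, so that j is an interior place of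
        it.\<close>
      define k where "k = nat (1 - j)"
      define i where "i = nat (j - 1 + int k)"
      have e: "int (Suc i) - int k = j" "int i - int k = j - 1" "int (i + 2) - int k = j + 1"
        by (auto simp: k_def i_def)
      show ?thesis using interior[OF Z[of k], of i] by (simp only: e)
    qed
    have "inj Z"
    proof (rule injI)
      fix i j assume eq: "Z i = Z j"
      define k where "k = nat (- min i j)"
      have ij: "int (nat (i + k)) - int k = i" "int (nat (j + k)) - int k = j" by (auto simp: k_def)
      have "inj (\<lambda>i. Z (int i - int k))" using Z[of k] by (simp add: half_line_def)
      then have "nat (i + k) = nat (j + k)" by (rule injD) (simp only: ij eq)
      then show "i = j" using ij by metis
    qed
    have "nbrs both_side_line j = {j - 1, j + 1}" for j
      by (auto simp: nbrs_def both_side_line_def mem_sym_closure)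
    then have "nbrs G (Z j) = Z ` nbrs both_side_line j" for j by (simp add: nb)
    moreover have "Z j \<in> verts G" for j
      using nbrs_subset[of "Z (j - 1)"] nb[of "j - 1"] by auto
    ultimately have "G \<simeq>\<^sub>G both_side_line"
      using \<open>inj Z\<close> by (intro graph_isoI[of Z]) (auto simp: both_side_line_def)
    then show ?thesis ..
  next
    case False
    then obtain X where X: "half_line X" "\<And>x. \<not> half_line (case_nat x X)" by blast
    have "a = X 1" if a: "X 0 \<leftrightarrow> a" for a
    proof (rule ccontr)
      assume "a \<noteq> X 1"
      have "a \<noteq> X n" for n
      proof
        assume eq: "a = X n"
        then obtain m where "n = Suc m" using a by (cases n) auto
        then have "X 0 \<in> {X m, X (m + 2)}"
          using interior[OF X(1), of m] a eq edge_sym[OF a] edge_in_nbrs by blast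
        then have "m = 0" using X(1) by (auto simp: half_line_def inj_eq)
        then show False using \<open>a \<noteq> X 1\<close> eq \<open>n = Suc m\<close> by simp
      qed
      then have "half_line (case_nat a X)"
        using X(1) edge_sym[OF a] by (auto simp: half_line_def inj_def split: nat.split)
      then show False using X(2) by blast
    qed
    then have "nbrs G (X 0) = {X 1}" using X(1) by (auto simp: half_line_def)
    moreover have "nbrs one_side_line (Suc n) = {n, n + 2}" "nbrs one_side_line 0 = {1}" for n
      by (auto simp: nbrs_def one_side_line_def mem_sym_closure)
    ultimately have "nbrs G (X n) = X ` nbrs one_side_line n" for n
      using interior[OF X(1)] by (cases n) auto
    moreover have "X ` UNIV \<subseteq> verts G" using X(1) edge_verts by (auto simp: half_line_def)
    ultimately have "G \<simeq>\<^sub>G one_side_line"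
      using X(1) by (intro graph_isoI[of X]) (auto simp: one_side_line_def half_line_def)
    then show ?thesis ..
  qed
qed

end

subsection \<open>Half-infinite ladders\<close>

locale ricci_graph = lf_graph G for G :: "'v ugraph" +
  assumes degree_le: "u \<in> verts G \<Longrightarrow> vdeg G u \<le> 3"
    and curvature_nonneg: "(u, v) \<in> adj G \<Longrightarrow> curvature G u v \<ge> 0"
begin

section \<open>Local consequences of nonnegative curvature\<close>

lemma laplace_mono:
  "u \<leftrightarrow> v \<Longrightarrow> lipschitz f \<Longrightarrow> f v = f u + 1 \<Longrightarrow> laplace f v \<le> laplace f u"
  using curvature_le curvature_nonneg by fastforce

lemma card_nbrs_le: "card (nbrs G u) \<le> 3"
proof (cases "u \<in> verts G")
  case True
  then show ?thesis using degree_le by (simp add: vdeg_def)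
next
  case False
  then have "nbrs G u = {}" using edge_verts by auto
  then show ?thesis by simp
qed

lemma nbrs_eq_3:
  assumes "u \<leftrightarrow> a" "u \<leftrightarrow> b" "u \<leftrightarrow> c" "distinct [a, b, c]"
  shows "nbrs G u = {a, b, c}"
  using assms card_nbrs_le[of u] by (intro card_seteq[symmetric]) auto

lemma nbrs_cases_2:
  assumes "u \<leftrightarrow> a" "u \<leftrightarrow> b" "a \<noteq> b"
  obtains "nbrs G u = {a, b}" | c where "c \<noteq> a" "c \<noteq> b" "nbrs G u = {a, b, c}"
proof (cases "nbrs G u = {a, b}")
  case False
  then have "\<exists>c. u \<leftrightarrow> c \<and> c \<noteq> a \<and> c \<noteq> b" using assms by (auto simp: set_eq_iff)
  then obtain c where "u \<leftrightarrow> c" "c \<noteq> a" "c \<noteq> b" by blast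
  then show thesis using that(2) nbrs_eq_3 assms by force
qed (use that in blast)

lemma nbrs_cases_1:
  assumes "u \<leftrightarrow> a"
  obtains "nbrs G u = {a}" | b where "b \<noteq> a" "nbrs G u = {a, b}"
  | b c where "b \<noteq> a" "c \<noteq> a" "c \<noteq> b" "nbrs G u = {a, b, c}"
proof (cases "nbrs G u = {a}")
  case False
  then have "\<exists>b. u \<leftrightarrow> b \<and> b \<noteq> a" using assms by (auto simp: set_eq_iff)
  then obtain b where "u \<leftrightarrow> b" "b \<noteq> a" by blast
  then show thesis using that(2,3) nbrs_cases_2[of u a b] assms by metis
qed (use that in blast)

text \<open>If both a and a' were at distance at least 3 from b, the minimum of the distances from a
  and a', minus 1, would be 0 at u, 1 at v, at most -1 at a and a', and at least 2 at b. Its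
  Laplacian would be at most -1 at u and at least 0 at v.\<close>

lemma curvature_3_2:
  assumes u: "nbrs G u = {v, a, a'}" "distinct [v, a, a']"
    and v: "nbrs G v = {u, b}" "u \<noteq> b"
    and far: "gdist G a b \<ge> 3"
  shows "gdist G a' b \<le> 2"
proof (rule ccontr)
  assume "\<not> ?thesis"
  then have far': "gdist G a' b \<ge> 3" by simp
  have e: "u \<leftrightarrow> v" "u \<leftrightarrow> a" "u \<leftrightarrow> a'" "v \<leftrightarrow> b" using u v by auto
  note V = e[THEN edge_verts]
  define f where "f w = min (real (gdist G a w)) (gdist G a' w) - 1" for w
  have lip: "lipschitz f"
    using lipschitz_gdist_from[of a] lipschitz_gdist_from[of a'] V
    unfolding lipschitz_def f_def by fastforce
  have au: "gdist G a u = 1" "gdist G a' u = 1" using e gdist_edge edge_sym by auto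
  then have av: "gdist G a v = 2" "gdist G a' v = 2"
    using gdist_step[of a u v] gdist_step[of a v b] gdist_step[of a' u v] gdist_step[of a' v b]
      e V far far' by auto
  have "f u = 0" "f v = 1" "f a \<le> -1" "f a' \<le> -1" "f b \<ge> 2"
    using au av far far' by (auto simp: f_def)
  moreover have "laplace f u = (f v - f u) + (f a - f u) + (f a' - f u)"
    using u by (simp add: laplace_def)
  moreover have "laplace f v = (f u - f v) + (f b - f v)"
    using v by (simp add: laplace_def)
  ultimately show False using laplace_mono[OF e(1) lip] by simp
qed

text \<open>The distance from a' is now raised by 1, since a' is only known to be at distance at
  least 2 from b and b'. The test function is 0 at u, 1 at v, at most -1 at a, at most 0 at a', and
  at least 2 at b and b'; the Laplacian rises from at most 0 at u to at least 1 at v.\<close>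

lemma curvature_3_3:
  assumes u: "nbrs G u = {v, a, a'}" "distinct [v, a, a']"
    and v: "nbrs G v = {u, b, b'}" "distinct [u, b, b']"
    and far: "gdist G a b \<ge> 3" "gdist G a b' \<ge> 3"
  shows "gdist G a' b \<le> 1 \<or> gdist G a' b' \<le> 1"
proof (rule ccontr)
  assume "\<not> ?thesis"
  then have far': "gdist G a' b \<ge> 2" "gdist G a' b' \<ge> 2" by auto
  have e: "u \<leftrightarrow> v" "u \<leftrightarrow> a" "u \<leftrightarrow> a'" "v \<leftrightarrow> b" "v \<leftrightarrow> b'" using u v by auto
  note V = e[THEN edge_verts]
  define f where "f w = min (real (gdist G a w)) (gdist G a' w + 1) - 1" for w
  have lip: "lipschitz f"
    using lipschitz_gdist_from[of a] lipschitz_gdist_from[of a'] V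
    unfolding lipschitz_def f_def by fastforce
  have au: "gdist G a u = 1" "gdist G a' u = 1" using e gdist_edge edge_sym by auto
  then have av: "gdist G a v = 2" "gdist G a' v \<ge> 1"
    using gdist_step[of a u v] gdist_step[of a v b] gdist_eq_0[of a' v] e V far u by auto
  have "f u = 0" "f v = 1" "f a \<le> -1" "f a' \<le> 0" "f b \<ge> 2" "f b' \<ge> 2"
    using au av far far' by (auto simp: f_def)
  moreover have "laplace f u = (f v - f u) + (f a - f u) + (f a' - f u)"
    using u by (simp add: laplace_def)
  moreover have "laplace f v = (f u - f v) + (f b - f v) + (f b' - f v)"
    using v by (simp add: laplace_def)
  ultimately show False using laplace_mono[OF e(1) lip] by simp
qed

text \<open>Only the presence of edges is required. The degree bound excludes all others at inner
  vertices, so that just \<open>X 0\<close> and \<open>Y 0\<close> can have a further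
  neighbour.\<close>

definition half_ladder :: "(nat \<Rightarrow> 'v) \<Rightarrow> (nat \<Rightarrow> 'v) \<Rightarrow> bool" where
  "half_ladder X Y \<longleftrightarrow> inj X \<and> inj Y \<and> range X \<inter> range Y = {} \<and>
     (\<forall>n. X n \<leftrightarrow> X (Suc n) \<and> Y n \<leftrightarrow> Y (Suc n) \<and> X n \<leftrightarrow> Y n)"

text \<open>Along a geodesic ray starting at a vertex of degree 3, the Laplacian of the distance from the
  origin is non-increasing and integral, hence eventually constant.  So the neighbours off the ray
  are eventually all at the same level relative to the ray, which leaves no other way to satisfy
  the curvature condition than joining consecutive ones.\<close>

lemma half_ladder_exists:
  assumes inf: "infinite (verts G)" and x0: "x\<^sub>0 \<in> verts G" "vdeg G x\<^sub>0 = 3"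
  obtains X Y where "half_ladder X Y"
proof -
  obtain x where x: "x 0 = x\<^sub>0" "\<And>n. x n \<leftrightarrow> x (Suc n)" "\<And>n. gdist G x\<^sub>0 (x n) = n"
    using geodesic_ray[OF inf x0(1)] by blast
  define r where "r = gdist G x\<^sub>0"
  have rx [simp]: "r (x n) = n" for n using x(3) by (simp add: r_def)
  have x_inj: "x m = x n \<longleftrightarrow> m = n" for m n using rx by metis
  have xv: "x n \<in> verts G" for n using x(2) edge_verts by blast
  have re: "r v \<le> r u + 1" if "u \<leftrightarrow> v" for u v
    using gdist_step[OF x0(1) that] by (simp add: r_def)
  have re': "r u \<le> r v + 1" if "u \<leftrightarrow> v" for u v using re that edge_sym by blast
  have rd: "r v \<le> r u + gdist G u v \<and> r u \<le> r v + gdist G u v"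
    if "u \<in> verts G" "v \<in> verts G" for u v
    using gdist_triangle[OF x0(1), of u v] gdist_triangle[OF x0(1), of v u] gdist_sym[of u v] that
    by (simp add: r_def)
  have lip: "lipschitz (\<lambda>w. real (r w))" unfolding r_def by (rule lipschitz_gdist_from[OF x0(1)])
  define c where "c n = laplace (\<lambda>w. real (r w)) (x n)" for n
  have c_anti: "c (Suc n) \<le> c n" for n
    unfolding c_def using x(2) lip by (rule laplace_mono) simp
  have xb: "x (Suc n) \<leftrightarrow> x n" for n using x(2) edge_sym by blast
  \<comment> \<open>The two ray neighbours contribute -1 and +1, so the Laplacian is the level of
    the third neighbour relative to the ray, or 0 if there is none.\<close>
  have cases: "(nbrs G (x (Suc n)) = {x n, x (n + 2)} \<and> c (Suc n) = 0) \<or>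
      (\<exists>y. nbrs G (x (Suc n)) = {x n, x (n + 2), y} \<and> y \<noteq> x n \<and> y \<noteq> x (n + 2) \<and>
        real (r y) = real (Suc n) + c (Suc n))" for n
  proof (rule nbrs_cases_2[of "x (Suc n)" "x n" "x (n + 2)"])
    assume "nbrs G (x (Suc n)) = {x n, x (n + 2)}"
    moreover from this have "c (Suc n) = 0" using x_inj[of n "n + 2"] by (simp add: c_def laplace_def)
    ultimately show ?thesis by blast
  next
    fix y assume y: "y \<noteq> x n" "y \<noteq> x (n + 2)" "nbrs G (x (Suc n)) = {x n, x (n + 2), y}"
    then have "real (r y) = real (Suc n) + c (Suc n)"
      using x_inj[of n "n + 2"] by (simp add: c_def laplace_def)
    then show ?thesis using y by blast
  qed (use xb x(2)[of "Suc n"] x_inj in auto)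
  have "c (Suc n) \<in> {-1, 0, 1}" for n
  proof -
    consider "c (Suc n) = 0" | y where "x (Suc n) \<leftrightarrow> y" "real (r y) = real (Suc n) + c (Suc n)"
      using cases[of n] by (metis insertCI mem_nbrs)
    then show ?thesis
    proof cases
      case 2
      then have "r y \<in> {n, n + 1, n + 2}" using re[OF 2(1)] re'[OF 2(1)] by auto
      then show ?thesis using 2(2) by auto
    qed simp
  qed
  note c_range = this
  obtain N where N: "\<And>n. n \<ge> N \<Longrightarrow> c n = c N"
    using antimono_finite_range_eventually_constant[of c "{-1, 0, 1}"] c_anti c_range by blast
  define k where "k = c N"
  have k: "k \<in> {-1, 0, 1}" using c_range[of N] N[of "Suc N"] by (simp add: k_def)
  define T where "T n \<longleftrightarrow> card (nbrs G (x n)) = 3" for n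
  \<comment> \<open>Meaningful only at positive indices where \<open>T\<close> holds; elsewhere the
    choice is arbitrary.\<close>
  define y where "y n = (SOME y. x n \<leftrightarrow> y \<and> y \<noteq> x (n - 1) \<and> y \<noteq> x (Suc n))" for n
  have y: "nbrs G (x (Suc n)) = {x n, x (n + 2), y (Suc n)} \<and> y (Suc n) \<noteq> x n \<and>
      y (Suc n) \<noteq> x (n + 2) \<and> real (r (y (Suc n))) = real (Suc n) + k"
    if T: "T (Suc n)" and n: "n \<ge> N" for n
  proof -
    have "nbrs G (x (Suc n)) \<noteq> {x n, x (n + 2)}" using that x_inj[of n "n + 2"] by (auto simp: T_def)
    then obtain z where z: "nbrs G (x (Suc n)) = {x n, x (n + 2), z}" "z \<noteq> x n" "z \<noteq> x (n + 2)"
      "real (r z) = real (Suc n) + k"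
      using cases[of n] N[of "Suc n"] n unfolding k_def by (metis le_SucI)
    have "x (Suc n) \<leftrightarrow> y (Suc n) \<and> y (Suc n) \<noteq> x (Suc n - 1) \<and> y (Suc n) \<noteq> x (Suc (Suc n))"
      unfolding y_def by (rule someI[of _ z]) (use z in auto)
    then have "y (Suc n) = z" using z(1) by (auto simp del: mem_nbrs simp flip: mem_nbrs)
    then show ?thesis using z by simp
  qed
  have noT: "nbrs G (x (Suc n)) = {x n, x (n + 2)} \<and> c (Suc n) = 0" if "\<not> T (Suc n)" for n
    using cases[of n] that x_inj[of n "n + 2"] by (auto simp: T_def)
  \<comment> \<open>If the neighbours off the ray are at the same level as the ray, then a path of length 2 from
    one of them can only reach the ray two steps ahead through the next one.\<close>
  have far: "gdist G (y (Suc n)) (x (n + 3)) \<ge> 3"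
    if n: "T (Suc n)" "n \<ge> N" "k = 0" and n': "\<not> x (n + 2) \<leftrightarrow> y (Suc n)" for n
  proof (rule ccontr)
    assume "\<not> ?thesis"
    then have "gdist G (y (Suc n)) (x (n + 3)) \<le> 2" by simp
    note Y = y[OF n(1,2)]
    have "x (Suc n) \<leftrightarrow> y (Suc n)" using Y by (auto simp flip: mem_nbrs)
    moreover have ry: "r (y (Suc n)) = Suc n" using Y n(3) by simp
    ultimately obtain w where w: "y (Suc n) \<leftrightarrow> w" "w \<leftrightarrow> x (n + 3)"
      using gdist_le_2D[of "y (Suc n)" "x (n + 3)"] \<open>gdist G (y (Suc n)) (x (n + 3)) \<le> 2\<close> xv edge_verts
        re[of "y (Suc n)" "x (n + 3)"] rx[of "n + 3"] by force
    have rw: "r w = n + 2" using re[OF w(1)] re[OF w(2)] ry by simp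
    have xw: "x (Suc (n + 2)) \<leftrightarrow> w" using w(2) edge_sym by (simp add: numeral_3_eq_3)
    have "w \<noteq> x (n + 2)" using w(1) n' edge_sym by auto
    moreover have "w \<noteq> x (n + 2 + 2)" using rw rx[of "n + 2 + 2"] by auto
    moreover have "w \<noteq> y (Suc (n + 2))" if "T (Suc (n + 2))"
      using y[OF that] n rw by auto
    ultimately show False
      using y[of "n + 2"] noT[of "n + 2"] n(2) edge_in_nbrs[OF xw]
      by (metis insertE empty_iff trans_le_add1)
  qed
  have "\<exists>M\<ge>N. \<forall>n\<ge>M. T (Suc n)"
  proof (cases "k = 0")
    case False
    \<comment> \<open>A ray vertex of degree 2 has Laplacian 0, which differs from \<open>k\<close>
      here.\<close>
    have "T (Suc n)" if "n \<ge> N" for n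
      using noT[of n] N[of "Suc n"] False that by (auto simp: k_def)
    then show ?thesis by blast
  next
    case True
    \<comment> \<open>Were the next ray vertex of degree 2, \<open>curvature_3_2\<close> would bring
      \<open>y (Suc n)\<close> within distance 2 of \<open>x (n + 3)\<close>, as \<open>x n\<close>
      is at distance 3 from it; this contradicts \<open>far\<close>.\<close>
    have step: "T (Suc (Suc n))" if n: "T (Suc n)" "n \<ge> N" for n
    proof (rule ccontr)
      assume nT: "\<not> T (Suc (Suc n))"
      note Y = y[OF n]
      have ry: "r (y (Suc n)) = Suc n" using Y True by simp
      have v: "nbrs G (x (n + 2)) = {x (Suc n), x (n + 3)}" using noT[OF nT] by (simp add: numeral_3_eq_3)
      have "x (Suc n) \<leftrightarrow> y (Suc n)" using Y by (metis insertCI mem_nbrs)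
      then have "y (Suc n) \<noteq> x (Suc n)" by auto
      moreover have "y (Suc n) \<noteq> x (n + 3)" using ry rx[of "n + 3"] by auto
      ultimately have "y (Suc n) \<notin> {x (Suc n), x (n + 3)}" by simp
      then have "\<not> x (n + 2) \<leftrightarrow> y (Suc n)" using v by (metis mem_nbrs)
      then have "gdist G (y (Suc n)) (x (n + 3)) \<ge> 3" using far n True by blast
      moreover have "gdist G (y (Suc n)) (x (n + 3)) \<le> 2"
      proof (rule curvature_3_2[of "x (Suc n)" "x (n + 2)" "x n"])
        show "gdist G (x n) (x (n + 3)) \<ge> 3" using rd[OF xv xv, of "n + 3" n] by simp
      qed (use Y v x_inj in auto)
      ultimately show False by simp
    qed
    \<comment> \<open>Here the degree of the origin is used: otherwise there is a last ray vertex of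
      degree 3, followed by a path of degree 2 vertices. Both its other neighbours are then at
      distance at least 3 from the ray vertex two steps ahead, against
      \<open>curvature_3_2\<close>.\<close>
    have "\<exists>n\<ge>N. T (Suc n)"
    proof (rule ccontr)
      assume no: "\<not> ?thesis"
      let ?S = "{n. n \<le> N \<and> T n}"
      have T0: "T 0" using x0(2) x(1) by (simp add: T_def vdeg_def)
      define n where "n = Max ?S"
      have "n \<in> ?S" unfolding n_def using T0 by (intro Max_in) auto
      then have n: "T n" by simp
      have above: "\<not> T (Suc m)" if "m \<ge> n" for m
      proof
        assume "T (Suc m)"
        then have "Suc m \<in> ?S" using no by (metis (no_types, lifting) mem_Collect_eq not_less_eq_eq)
        then have "Suc m \<le> n" unfolding n_def by (intro Max_ge) auto
        then show False using that by simp
      qed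
      have v: "nbrs G (x (Suc n)) = {x n, x (n + 2)}" using noT above by blast
      have v2: "nbrs G (x (n + 2)) = {x (Suc n), x (n + 3)}"
        using noT[of "Suc n"] above by (simp add: numeral_3_eq_3)
      have v3: "nbrs G (x (n + 3)) = {x (n + 2), x (n + 4)}"
        using noT[of "n + 2"] above by (simp add: numeral_3_eq_3 eval_nat_numeral)
      obtain b b' where b: "nbrs G (x n) = {x (Suc n), b, b'}" "distinct [x (Suc n), b, b']"
      proof (rule nbrs_cases_1[OF x(2)[of n]])
        fix b b' assume "b \<noteq> x (Suc n)" "b' \<noteq> x (Suc n)" "b' \<noteq> b" "nbrs G (x n) = {x (Suc n), b, b'}"
        then show thesis using that by auto
      qed (use n in \<open>auto simp: T_def\<close>)
      have far: "gdist G d (x (n + 2)) \<ge> 3" if d: "x n \<leftrightarrow> d" "d \<noteq> x (Suc n)" for d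
      proof (rule ccontr)
        assume "\<not> ?thesis"
        then have "d = x (n + 2) \<or> d \<leftrightarrow> x (n + 2) \<or> (\<exists>w. d \<leftrightarrow> w \<and> w \<leftrightarrow> x (n + 2))"
          using gdist_le_2D[of d "x (n + 2)"] d(1) edge_verts xv by auto
        moreover have "r d \<le> Suc n" using re[OF d(1)] by simp
        moreover have "d \<noteq> x n" using d(1) by auto
        ultimately show False
          using d(2) v v2 v3 edge_commute[of d] edge_commute[of _ "x (n + 2)"] rx[of "n + 2"] rx[of "n + 3"] rx[of "n + 4"]
          by (auto simp flip: mem_nbrs)
      qed
      have "gdist G b' (x (n + 2)) \<le> 2"
        using curvature_3_2[OF b v] far[of b] b x_inj by (auto simp flip: mem_nbrs)
      moreover have "gdist G b' (x (n + 2)) \<ge> 3"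
        using far[of b'] b by (auto simp flip: mem_nbrs)
      ultimately show False by simp
    qed
    then obtain M where M: "M \<ge> N" "T (Suc M)" by blast
    have "T (Suc n)" if "n \<ge> M" for n
      using that by (induction n rule: dec_induct) (use M step in auto)
    then show ?thesis using M by blast
  qed
  then obtain M where M: "M \<ge> N" "\<And>n. n \<ge> M \<Longrightarrow> T (Suc n)" by blast
  note y = y[OF M(2)]
  have nb: "nbrs G (x (Suc n)) = {x n, x (n + 2), y (Suc n)}"
    and y_ne: "y (Suc n) \<noteq> x n" "y (Suc n) \<noteq> x (n + 2)"
    and ry: "real (r (y (Suc n))) = real (Suc n) + k"
    if "n \<ge> M" for n using y[of n] that M(1) by auto
  have xy: "x (Suc n) \<leftrightarrow> y (Suc n)" if "n \<ge> M" for n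
    using nb[OF that] by (auto simp flip: mem_nbrs)
  have yv: "y (Suc n) \<in> verts G" if "n \<ge> M" for n using xy[OF that] edge_verts by blast
  have y_ne_x: "y (Suc n) \<noteq> x m" if "n \<ge> M" for m n
  proof
    assume eq: "y (Suc n) = x m"
    then have "real m = real (Suc n) + k" using ry[OF that] by simp
    then have "m \<in> {n, n + 1, n + 2}" using k by auto
    then show False using eq y_ne[OF that] xy[OF that] by auto
  qed
  have y_inj: "y (Suc m) = y (Suc n) \<longleftrightarrow> m = n" if "m \<ge> M" "n \<ge> M" for m n
  proof
    assume "y (Suc m) = y (Suc n)"
    then have "real (Suc m) + k = real (Suc n) + k" using ry that by metis
    then show "m = n" by simp
  qed simp
  \<comment> \<open>\<open>curvature_3_3\<close> is applied to the ray edge below, outward if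
    \<open>k\<close> is 1 and inward otherwise. The direction is chosen so that the ray neighbour of
    the first endpoint is at distance at least 3 from both targets. The alternative, an edge from a
    side vertex to a ray vertex two steps away, is excluded by saturation.\<close>
  have yy: "y (Suc (Suc n)) \<leftrightarrow> y (Suc (Suc (Suc n)))" if n: "n \<ge> M" for n
  proof -
    let ?u = "x (n + 2)" and ?v = "x (n + 3)"
    have u: "nbrs G ?u = {x (n + 1), ?v, y (n + 2)}" using nb[of "Suc n"] n by (simp add: numeral_3_eq_3)
    have v: "nbrs G ?v = {?u, x (n + 4), y (n + 3)}"
      using nb[of "n + 2"] n by (simp add: eval_nat_numeral)
    have du: "distinct [?v, x (n + 1), y (n + 2)]" "distinct [?u, x (n + 4), y (n + 3)]"
      using y_ne_x[of "n + 1"] y_ne_x[of "n + 2"] n x_inj by (auto simp: numeral_3_eq_3, metis+)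
    have r2: "real (r (y (n + 2))) = real (n + 2) + k" and r3: "real (r (y (n + 3))) = real (n + 3) + k"
      using ry[of "n + 1"] ry[of "n + 2"] n by (auto simp: numeral_3_eq_3)
    have V: "y (n + 2) \<in> verts G" "y (n + 3) \<in> verts G"
      using yv[of "n + 1"] yv[of "n + 2"] n by (auto simp: numeral_3_eq_3)
    have y_ne': "y (n + 2) \<noteq> y (n + 3)" using y_inj[of "n + 1" "n + 2"] n by (simp add: numeral_3_eq_3)
    have "y (n + 2) \<leftrightarrow> y (n + 3)"
    proof (cases "k = 1")
      case True
      have "gdist G (y (n + 2)) (x (n + 4)) \<le> 1 \<or> gdist G (y (n + 2)) (y (n + 3)) \<le> 1"
      proof (rule curvature_3_3[of ?u ?v "x (n + 1)"])
        show "gdist G (x (n + 1)) (x (n + 4)) \<ge> 3" using rd[OF xv xv, of "n + 4" "n + 1"] by simp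
        show "gdist G (x (n + 1)) (y (n + 3)) \<ge> 3"
          using rd[OF xv V(2), of "n + 1"] r3 True by simp
      qed (use u v du in auto)
      moreover have "\<not> gdist G (y (n + 2)) (x (n + 4)) \<le> 1"
      proof
        assume "gdist G (y (n + 2)) (x (n + 4)) \<le> 1"
        then have "x (n + 4) \<leftrightarrow> y (n + 2)"
          using gdist_le_1D[OF V(1) xv[of "n + 4"]] y_ne_x[of "n + 1" "n + 4"] n edge_sym by auto
        then have "y (n + 2) \<in> {x (n + 3), x (n + 5), y (n + 4)}"
          using nb[of "n + 3"] n by (auto simp: eval_nat_numeral simp flip: mem_nbrs)
        then show False
          using y_ne_x[of "n + 1"] y_inj[of "n + 1" "n + 3"] n by (auto simp: eval_nat_numeral)
      qed
      ultimately show ?thesis using gdist_le_1D[OF V] y_ne' by blast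
    next
      case False
      have "gdist G (x (n + 4)) (y (n + 2)) \<ge> 3"
      proof (cases "k = 0")
        case True
        have "\<not> ?v \<leftrightarrow> y (n + 2)"
        proof
          assume "?v \<leftrightarrow> y (n + 2)"
          then have "y (n + 2) \<in> {?u, x (n + 4), y (n + 3)}" using v by (metis mem_nbrs)
          then show False using y_ne' y_ne_x[of "n + 1"] n by auto
        qed
        then show ?thesis
          using far[of "n + 1"] M n True gdist_sym[OF V(1) xv[of "n + 4"]]
          by (simp add: eval_nat_numeral)
      next
        case False
        then have "k = -1" using k \<open>k \<noteq> 1\<close> by auto
        then show ?thesis using rd[OF xv V(1), of "n + 4"] r2 by simp
      qed
      then have "gdist G (y (n + 3)) (x (n + 1)) \<le> 1 \<or> gdist G (y (n + 3)) (y (n + 2)) \<le> 1"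
        using u v du rd[OF xv xv, of "n + 4" "n + 1"] gdist_sym[OF xv xv, of "n + 4" "n + 1"]
        by (intro curvature_3_3[of ?v ?u "x (n + 4)"]) auto
      moreover have "\<not> gdist G (y (n + 3)) (x (n + 1)) \<le> 1"
      proof
        assume "gdist G (y (n + 3)) (x (n + 1)) \<le> 1"
        then have "x (n + 1) \<leftrightarrow> y (n + 3)"
          using gdist_le_1D[OF V(2) xv[of "n + 1"]] y_ne_x[of "n + 2" "n + 1"] n edge_sym
          by (auto simp: eval_nat_numeral)
        then have "y (n + 3) \<in> {x n, x (n + 2), y (n + 1)}"
          using nb[of n] n by (auto simp: eval_nat_numeral simp flip: mem_nbrs)
        then show False
          using y_ne_x[of "n + 2"] y_inj[of "n + 2" n] n by (auto simp: eval_nat_numeral)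
      qed
      ultimately show ?thesis using gdist_le_1D[OF V(2,1)] y_ne' edge_sym by auto
    qed
    then show ?thesis by (simp add: numeral_3_eq_3)
  qed
  have "half_ladder (\<lambda>n. x (Suc (Suc (M + n)))) (\<lambda>n. y (Suc (Suc (M + n))))"
    unfolding half_ladder_def
  proof (intro conjI allI)
    show "inj (\<lambda>n. y (Suc (Suc (M + n))))"
      using y_inj[of "Suc (M + _)" "Suc (M + _)"] by (auto simp: inj_def)
    show "range (\<lambda>n. x (Suc (Suc (M + n)))) \<inter> range (\<lambda>n. y (Suc (Suc (M + n)))) = {}"
    proof -
      have "x m \<noteq> y (Suc (Suc (M + n)))" for m n using y_ne_x[of "Suc (M + n)" m] by auto
      then show ?thesis by auto
    qed
  qed (use x x_inj yy xy[of "Suc (M + _)"] in \<open>auto simp: inj_def\<close>)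
  then show thesis using that by blast
qed

lemma half_ladder_swap: "half_ladder X Y \<Longrightarrow> half_ladder Y X"
  using edge_sym by (auto simp: half_ladder_def)

lemma half_ladder_edges:
  assumes "half_ladder X Y"
  shows "X n \<leftrightarrow> X (Suc n)" "X (Suc n) \<leftrightarrow> X n" "Y n \<leftrightarrow> Y (Suc n)" "Y (Suc n) \<leftrightarrow> Y n"
    "X n \<leftrightarrow> Y n" "Y n \<leftrightarrow> X n"
  using assms edge_sym by (auto simp: half_ladder_def)

lemma half_ladder_distinct:
  assumes "half_ladder X Y"
  shows "X m = X n \<longleftrightarrow> m = n" "Y m = Y n \<longleftrightarrow> m = n" "X m \<noteq> Y n" "Y m \<noteq> X n"
  using assms by (auto simp: half_ladder_def inj_eq disjoint_iff)

lemma half_ladder_interior: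
  assumes "half_ladder X Y"
  shows "nbrs G (X (Suc n)) = {X n, X (Suc (Suc n)), Y (Suc n)}"
    "nbrs G (Y (Suc n)) = {Y n, Y (Suc (Suc n)), X (Suc n)}"
  by (rule nbrs_eq_3; use half_ladder_edges[OF assms] half_ladder_distinct[OF assms] in simp)+

lemma half_ladder_verts: "half_ladder X Y \<Longrightarrow> X n \<in> verts G \<and> Y n \<in> verts G"
  using half_ladder_edges edge_verts by metis

section \<open>Isomorphisms with the model ladders\<close>

lemma infinite_ladder_iso:
  assumes ladder: "half_ladder X Y"
    and ext: "\<And>X Y. half_ladder X Y \<Longrightarrow> \<exists>x y. half_ladder (case_nat x X) (case_nat y Y)"
  shows "G \<simeq>\<^sub>G infinite_ladder"
proof -
  \<comment> \<open>Both sides have to grow together, hence one sequence of pairs.\<close>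
  define P where "P Z \<longleftrightarrow> half_ladder (fst \<circ> Z) (snd \<circ> Z)" for Z
  have "\<exists>z. P (case_nat z Z)" if Z: "P Z" for Z
  proof -
    obtain x y where "half_ladder (case_nat x (fst \<circ> Z)) (case_nat y (snd \<circ> Z))"
      using ext Z unfolding P_def by blast
    moreover have "fst \<circ> case_nat (x, y) Z = case_nat x (fst \<circ> Z)"
      "snd \<circ> case_nat (x, y) Z = case_nat y (snd \<circ> Z)"
      by (auto simp: fun_eq_iff split: nat.split)
    ultimately show ?thesis unfolding P_def by metis
  qed
  moreover have "P (\<lambda>n. (X n, Y n))" using ladder by (simp add: P_def comp_def)
  ultimately obtain Z :: "int \<Rightarrow> 'v \<times> 'v" where Z: "\<And>k. P (\<lambda>i. Z (int i - int k))"
    using extend_to_int[of P "\<lambda>n. (X n, Y n)"] by metis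
  define x y where "x j = fst (Z j)" and "y j = snd (Z j)" for j
  have L: "half_ladder (\<lambda>i. x (int i - int k)) (\<lambda>i. y (int i - int k))" for k
    using Z[of k] by (simp add: P_def comp_def x_def y_def)
  have nb: "nbrs G (x j) = {x (j - 1), x (j + 1), y j}" "nbrs G (y j) = {y (j - 1), y (j + 1), x j}" for j
  proof -
    define k where "k = nat (1 - j)"
    define i where "i = nat (j - 1 + int k)"
    have e: "int (Suc i) - int k = j" "int i - int k = j - 1" "int (Suc (Suc i)) - int k = j + 1"
      by (auto simp: k_def i_def)
    show "nbrs G (x j) = {x (j - 1), x (j + 1), y j}" "nbrs G (y j) = {y (j - 1), y (j + 1), x j}"
      using half_ladder_interior[OF L[of k], of i] by (simp_all only: e)
  qed
  have distinct: "x i = x j \<longleftrightarrow> i = j" "y i = y j \<longleftrightarrow> i = j" "x i \<noteq> y j" "y j \<noteq> x i" for i j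
  proof -
    define k where "k = nat (- min i j)"
    have ij: "int (nat (i + k)) - int k = i" "int (nat (j + k)) - int k = j" by (auto simp: k_def)
    then have "nat (i + k) = nat (j + k) \<longleftrightarrow> i = j" by linarith
    then show "x i = x j \<longleftrightarrow> i = j" "y i = y j \<longleftrightarrow> i = j" "x i \<noteq> y j" "y j \<noteq> x i"
      using half_ladder_distinct[OF L[of k], of "nat (i + k)" "nat (j + k)"] unfolding ij by auto
  qed
  define f where "f = (\<lambda>(j, b). if b then y j else x j)"
  have "nbrs infinite_ladder (j, b) = {(j - 1, b), (j + 1, b), (j, \<not> b)}" for j b
    by (cases b) (auto simp: nbrs_def infinite_ladder_def cartesian_product_def both_side_line_def
        K2_def mem_sym_closure)
  then have "nbrs G (f h) = f ` nbrs infinite_ladder h" for h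
    by (cases h) (auto simp: f_def nb)
  moreover have "inj f" by (auto simp: inj_def f_def distinct split: if_splits)
  moreover have "x j \<in> verts G" "y j \<in> verts G" for j
    using nbrs_subset[of "x (j - 1)"] nbrs_subset[of "x j"] nb(1)[of "j - 1"] nb(1)[of j] by auto
  then have "f h \<in> verts G" for h by (cases h) (auto simp: f_def)
  ultimately show ?thesis
    by (intro graph_isoI[of f])
      (auto simp: infinite_ladder_def cartesian_product_def both_side_line_def K2_def)
qed

text \<open>The share of the extra edges in a neighbourhood of the model. Separating it from the
  ladder edges lets each explicit end be checked by evaluation with
  \<open>end_nbrs_simps\<close>.\<close>

definition end_nbrs :: "qvertex rel \<Rightarrow> qvertex \<Rightarrow> qvertex set" where
  "end_nbrs F h = {q. (h, q) \<in> sym_closure F}"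

lemma half_ladder_with_iso:
  assumes ladder: "half_ladder X Y"
    and fX: "\<And>n. f (Vx n) = X n" and fY: "\<And>n. f (Vy n) = Y n"
    and W: "W \<inter> (range Vx \<union> range Vy) = {}" "inj_on f W" "f ` W \<inter> (range X \<union> range Y) = {}"
    and F: "F \<subseteq> (W \<union> {Vx 0, Vy 0}) \<times> (W \<union> {Vx 0, Vy 0})"
    and x: "nbrs G (X 0) = {X 1, Y 0} \<union> f ` end_nbrs F (Vx 0)"
    and y: "nbrs G (Y 0) = {Y 1, X 0} \<union> f ` end_nbrs F (Vy 0)"
    and w: "\<And>h. h \<in> W \<Longrightarrow> nbrs G (f h) = f ` end_nbrs F h \<and> nbrs G (f h) \<noteq> {}"
  shows "G \<simeq>\<^sub>G half_ladder_with W F"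
proof (rule graph_isoI[of f])
  let ?H = "half_ladder_with W F"
  have verts: "verts ?H = range Vx \<union> range Vy \<union> W" by (simp add: half_ladder_with_def)
  show "verts ?H \<noteq> {}" by (auto simp: verts)
  show "adj ?H \<subseteq> verts ?H \<times> verts ?H"
    using F by (auto simp: half_ladder_with_def sym_closure_def half_ladder_edges_def)
  show "inj_on f (verts ?H)"
    unfolding verts inj_on_Un using W half_ladder_distinct[OF ladder]
    by (fastforce simp: inj_on_def fX fY)
  have base: "nbrs ?H h = end_nbrs half_ladder_edges h \<union> end_nbrs F h" for h
    by (auto simp: nbrs_def half_ladder_with_def end_nbrs_def mem_sym_closure)
  have E: "end_nbrs half_ladder_edges (Vx 0) = {Vx 1, Vy 0}"
    "end_nbrs half_ladder_edges (Vy 0) = {Vy 1, Vx 0}"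
    "end_nbrs half_ladder_edges (Vx (Suc n)) = {Vx n, Vx (Suc (Suc n)), Vy (Suc n)}"
    "end_nbrs half_ladder_edges (Vy (Suc n)) = {Vy n, Vy (Suc (Suc n)), Vx (Suc n)}" for n
    by (auto simp: end_nbrs_def mem_sym_closure half_ladder_edges_def)
  have EW: "end_nbrs half_ladder_edges h = {}" if "h \<in> W" for h
    using that W(1) by (auto simp: end_nbrs_def mem_sym_closure half_ladder_edges_def)
  have F0: "end_nbrs F (Vx (Suc n)) = {}" "end_nbrs F (Vy (Suc n)) = {}" for n
    using F W(1) by (auto simp: end_nbrs_def mem_sym_closure)
  show nb: "nbrs G (f h) = f ` nbrs ?H h" if h: "h \<in> verts ?H" for h
  proof -
    consider n where "h = Vx n" | n where "h = Vy n" | "h \<in> W"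
      using h unfolding verts by blast
    then consider "h = Vx 0" | "h = Vy 0" | n where "h = Vx (Suc n)" | n where "h = Vy (Suc n)"
      | "h \<in> W"
      by cases (metis not0_implies_Suc)+
    then show ?thesis
    proof cases
      case 5
      then show ?thesis using w EW by (simp add: base)
    qed (simp_all only: base image_Un fX fY x y E F0 image_insert image_empty Un_empty_right
        half_ladder_interior[OF ladder])
  qed
  have "f h \<in> verts G" if "h \<in> W" for h using w[OF that] edge_verts by fastforce
  then show "f ` verts ?H \<subseteq> verts G"
    using half_ladder_verts[OF ladder] by (auto simp: verts fX fY)
qed

subsection \<open>The end of a half-infinite ladder\<close>

text \<open>Maximality refers to whole rungs; single vertices may still be attached to the first
  one.\<close>

definition end_ladder :: "(nat \<Rightarrow> 'v) \<Rightarrow> (nat \<Rightarrow> 'v) \<Rightarrow> bool" where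
  "end_ladder X Y \<longleftrightarrow> half_ladder X Y \<and> (\<forall>x y. \<not> half_ladder (case_nat x X) (case_nat y Y))"

lemma half_ladder_extend:
  assumes "half_ladder X Y" "X 0 \<leftrightarrow> a" "Y 0 \<leftrightarrow> b" "a \<leftrightarrow> b"
    "a \<notin> range X \<union> range Y" "b \<notin> range X \<union> range Y"
  shows "half_ladder (case_nat a X) (case_nat b Y)"
proof -
  have "a \<noteq> b" using assms(4) by auto
  then show ?thesis
    using assms half_ladder_distinct[OF assms(1)] half_ladder_edges[OF assms(1)] edge_sym
    unfolding half_ladder_def inj_def disjoint_iff by (auto split: nat.splits)
qed

lemma end_ladder_swap:
  assumes "end_ladder X Y"
  shows "end_ladder Y X"
  using assms half_ladder_swap unfolding end_ladder_def by blast

lemma half_ladder_exit: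
  assumes ladder: "half_ladder X Y" and v: "v \<in> range X \<union> range Y"
    and w: "v \<leftrightarrow> w" "w \<notin> range X \<union> range Y"
  shows "v = X 0 \<or> v = Y 0"
proof -
  consider n where "v = X n" | n where "v = Y n" using v by blast
  then show ?thesis
  proof cases
    case 1
    then show ?thesis
      using edge_in_nbrs[OF w(1)] half_ladder_interior(1)[OF ladder] w(2) by (cases n) auto
  next
    case 2
    then show ?thesis
      using edge_in_nbrs[OF w(1)] half_ladder_interior(2)[OF ladder] w(2) by (cases n) auto
  qed
qed

lemma gdist_ge_3I:
  assumes "u \<in> verts G" "v \<in> verts G" "u \<noteq> v" "\<not> u \<leftrightarrow> v" "\<And>w. u \<leftrightarrow> w \<Longrightarrow> \<not> w \<leftrightarrow> v"
  shows "gdist G u v \<ge> 3"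
  using gdist_le_2D[OF assms(1,2)] assms(3-5) by force

lemma nbrs_end:
  assumes "half_ladder X Y" "X 0 \<leftrightarrow> a" "a \<notin> range X \<union> range Y"
  shows "nbrs G (X 0) = {X 1, Y 0, a}"
  using assms half_ladder_edges[OF assms(1), of 0] half_ladder_distinct[OF assms(1)]
  by (intro nbrs_eq_3) auto

text \<open>\<open>X 1\<close> is at distance at least 3 from every further neighbour of a, so the
  curvature of the edge from \<open>X 0\<close> to a obliges \<open>Y 0\<close> to be close to one.
  With two further neighbours \<open>Y 0\<close> would have to be adjacent to one of them, which
  would form a new rung with a. With a single one, distance 2 supplies w.\<close>

lemma nbrs_beyond_end:
  assumes maximal: "end_ladder X Y" and a: "X 0 \<leftrightarrow> a" "a \<notin> range X \<union> range Y" "\<not> a \<leftrightarrow> Y 0"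
  obtains "nbrs G a = {X 0}"
  | c w where "nbrs G a = {X 0, c}" "c \<noteq> a" "c \<notin> range X \<union> range Y"
      "Y 0 \<leftrightarrow> w" "w \<notin> range X \<union> range Y" "w \<leftrightarrow> c"
proof -
  let ?L = "range X \<union> range Y"
  have ladder: "half_ladder X Y" using maximal by (simp add: end_ladder_def)
  note dist = half_ladder_distinct[OF ladder]
  have X0: "nbrs G (X 0) = {a, X 1, Y 0}" using nbrs_end[OF ladder a(1,2)] by auto
  have d0: "distinct [a, X 1, Y 0]" using a(2) dist by auto
  have off: "b \<notin> ?L" if "a \<leftrightarrow> b" "b \<noteq> X 0" for b
    using half_ladder_exit[OF ladder _ edge_sym[OF that(1)] a(2)] that a(3) by metis
  have not_Y0: "\<not> Y 0 \<leftrightarrow> b" if "a \<leftrightarrow> b" "b \<noteq> X 0" for b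
    using half_ladder_extend[OF ladder a(1) _ that(1) a(2) off[OF that]] maximal
    by (auto simp: end_ladder_def)
  have not_X0: "\<not> X 0 \<leftrightarrow> b" if "a \<leftrightarrow> b" "b \<noteq> X 0" for b
    using edge_in_nbrs[OF _ X0, of b] off[OF that] that by auto
  have far: "gdist G (X 1) b \<ge> 3" if b: "a \<leftrightarrow> b" "b \<noteq> X 0" for b
  proof (rule gdist_ge_3I)
    show "X 1 \<in> verts G" "b \<in> verts G" using half_ladder_verts[OF ladder] b edge_verts by auto
    show "X 1 \<noteq> b" using off[OF b] by auto
    show "\<not> X 1 \<leftrightarrow> b" using half_ladder_exit[OF ladder _ _ off[OF b], of "X 1"] dist by auto
    show "\<not> w \<leftrightarrow> b" if "X 1 \<leftrightarrow> w" for w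
    proof
      assume "w \<leftrightarrow> b"
      have w: "w \<in> {X 0, X 2, Y 1}"
        using edge_in_nbrs[OF that] half_ladder_interior(1)[OF ladder, of 0] by (simp add: numeral_2_eq_2)
      then have "w = X 0 \<or> w = Y 0"
        using half_ladder_exit[OF ladder _ \<open>w \<leftrightarrow> b\<close> off[OF b]] by auto
      then show False using w dist \<open>w \<leftrightarrow> b\<close> not_X0[OF b] by auto
    qed
  qed
  note Y0v = half_ladder_verts[OF ladder, of 0, THEN conjunct2]
  show thesis
  proof (rule nbrs_cases_1[OF edge_sym[OF a(1)]])
    fix b assume b: "b \<noteq> X 0" "nbrs G a = {X 0, b}"
    then have ab: "a \<leftrightarrow> b" by (metis insertCI mem_nbrs)
    have "gdist G (Y 0) b \<le> 2"
      using curvature_3_2[OF X0 d0 b(2)] far[OF ab b(1)] b(1) by auto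
    then obtain w where w: "Y 0 \<leftrightarrow> w" "w \<leftrightarrow> b"
      using gdist_le_2D[OF Y0v] ab edge_verts not_Y0[OF ab b(1)] off[OF ab b(1)] by blast
    have "w \<notin> ?L"
      using half_ladder_exit[OF ladder _ w(2) off[OF ab b(1)]] not_X0[OF ab b(1)] w by auto
    moreover have "b \<noteq> a" using ab by auto
    ultimately show thesis using that(2) b w off[OF ab b(1)] by blast
  next
    fix b b' assume b: "b \<noteq> X 0" "b' \<noteq> X 0" "b' \<noteq> b" "nbrs G a = {X 0, b, b'}"
    then have ab: "a \<leftrightarrow> b" "a \<leftrightarrow> b'" by (metis insertCI mem_nbrs)+
    have "gdist G (Y 0) b \<le> 1 \<or> gdist G (Y 0) b' \<le> 1"
      using curvature_3_3[OF X0 d0 b(4)] far ab b by auto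
    then show thesis
      using gdist_le_1D[OF Y0v] ab edge_verts not_Y0[OF ab(1) b(1)] off[OF ab(1) b(1)]
        not_Y0[OF ab(2) b(2)] off[OF ab(2) b(2)] by blast
  qed (use that(1) in blast)
qed

text \<open>Any further neighbour q of p would be far from both s and t, whereas curvature on the
  edge zp needs one of them close.\<close>

lemma pendant:
  assumes z: "nbrs G z = {p, s, t}" "distinct [p, s, t]"
    and far: "\<And>q. p \<leftrightarrow> q \<Longrightarrow> q \<noteq> z \<Longrightarrow> gdist G s q \<ge> 3 \<and> gdist G t q \<ge> 3"
  shows "nbrs G p = {z}"
proof -
  have pz: "p \<leftrightarrow> z" using z(1) edge_sym by (metis insertCI mem_nbrs)
  show ?thesis
  proof (rule nbrs_cases_1[OF pz])
    fix q assume q: "q \<noteq> z" "nbrs G p = {z, q}"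
    then have "p \<leftrightarrow> q" by (metis insertCI mem_nbrs)
    then show ?thesis using curvature_3_2[OF z q(2)] far[of q] q by force
  next
    fix q q' assume q: "q \<noteq> z" "q' \<noteq> z" "q' \<noteq> q" "nbrs G p = {z, q, q'}"
    then have "p \<leftrightarrow> q" "p \<leftrightarrow> q'" by (metis insertCI mem_nbrs)+
    then show ?thesis using curvature_3_3[OF z q(4)] far[of q] far[of q'] q by force
  qed
qed

lemma end_nbrs_simps:
  "end_nbrs {} h = {}"
  "end_nbrs (insert (p, q) F) h =
     (if h = p then {q} else {}) \<union> (if h = q then {p} else {}) \<union> end_nbrs F h"
  by (auto simp: end_nbrs_def mem_sym_closure)

text \<open>The triangle saturates \<open>X 0\<close> and \<open>Y 0\<close>, so only z can lead on.
  A third neighbour p of z is pendant: whatever lies behind p is reached from the first rung only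
  through z and p, in at least three steps.\<close>

lemma triangle_end_iso:
  assumes ladder: "half_ladder X Y" and z: "X 0 \<leftrightarrow> z" "Y 0 \<leftrightarrow> z" "z \<notin> range X \<union> range Y"
  shows "G \<simeq>\<^sub>G quasi_ladder_E4 \<or> G \<simeq>\<^sub>G quasi_ladder_E5"
proof -
  let ?L = "range X \<union> range Y"
  note dist = half_ladder_distinct[OF ladder]
  have X0: "nbrs G (X 0) = {X 1, Y 0, z}" using nbrs_end[OF ladder z(1,3)] .
  have Y0: "nbrs G (Y 0) = {Y 1, X 0, z}" using nbrs_end[OF half_ladder_swap[OF ladder] z(2)] z(3) by auto
  show ?thesis
  proof (rule nbrs_cases_2[of z "X 0" "Y 0"])
    assume nz: "nbrs G z = {X 0, Y 0}"
    have "G \<simeq>\<^sub>G quasi_ladder_E4"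
      unfolding quasi_ladder_E4_def
      by (rule half_ladder_with_iso[OF ladder, where f = "case_qvertex X Y z z z z z z"])
        (use z X0 Y0 nz in \<open>auto simp: end_nbrs_simps\<close>)
    then show ?thesis ..
  next
    fix p assume p: "p \<noteq> X 0" "p \<noteq> Y 0" "nbrs G z = {X 0, Y 0, p}"
    then have zp: "z \<leftrightarrow> p" by (metis insertCI mem_nbrs)
    then have pz: "p \<noteq> z" by auto
    have pL: "p \<notin> ?L" using half_ladder_exit[OF ladder _ edge_sym[OF zp] z(3)] p by auto
    have np: "\<not> X 0 \<leftrightarrow> p" "\<not> Y 0 \<leftrightarrow> p"
      using edge_in_nbrs[OF _ X0, of p] edge_in_nbrs[OF _ Y0, of p] pL pz by auto
    have "nbrs G p = {z}"
    proof (rule pendant[of z p "X 0" "Y 0"])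
      fix q assume q: "p \<leftrightarrow> q" "q \<noteq> z"
      have qL: "q \<notin> ?L" using half_ladder_exit[OF ladder _ edge_sym[OF q(1)] pL] np edge_sym[OF q(1)] by metis
      have nq: "\<not> X 0 \<leftrightarrow> q" "\<not> Y 0 \<leftrightarrow> q" "\<not> z \<leftrightarrow> q"
        using edge_in_nbrs[OF _ X0, of q] edge_in_nbrs[OF _ Y0, of q] edge_in_nbrs[OF _ p(3), of q] qL q
        by auto
      have n1: "\<not> X 1 \<leftrightarrow> q" "\<not> Y 1 \<leftrightarrow> q"
        using half_ladder_exit[OF ladder _ _ qL, of "X 1"]
          half_ladder_exit[OF ladder _ _ qL, of "Y 1"] dist by auto
      have "\<not> w \<leftrightarrow> q" if "X 0 \<leftrightarrow> w \<or> Y 0 \<leftrightarrow> w" for w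
        using that edge_in_nbrs[OF _ X0, of w] edge_in_nbrs[OF _ Y0, of w] nq n1 by auto
      then show "gdist G (X 0) q \<ge> 3 \<and> gdist G (Y 0) q \<ge> 3"
        using nq qL half_ladder_verts[OF ladder, of 0] q(1) edge_verts
        by (intro conjI gdist_ge_3I) auto
    qed (use p dist in auto)
    then have "G \<simeq>\<^sub>G quasi_ladder_E5"
      unfolding quasi_ladder_E5_def
      by (intro half_ladder_with_iso[OF ladder, where f = "case_qvertex X Y z z z z p z"])
        (use z X0 Y0 p pL pz in \<open>auto simp: end_nbrs_simps\<close>)
    then show ?thesis ..
  qed (use z edge_sym dist in auto)
qed

text \<open>The pentagon closes the end in the same manner, with c in the role of z and a, b in that
  of the first rung.\<close>

lemma pentagon_end_iso:
  assumes ladder: "half_ladder X Y" and ab: "X 0 \<leftrightarrow> a" "Y 0 \<leftrightarrow> b" "a \<noteq> b"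
    "a \<notin> range X \<union> range Y" "b \<notin> range X \<union> range Y"
    and c: "nbrs G a = {X 0, c}" "nbrs G b = {Y 0, c}" "c \<notin> range X \<union> range Y" "c \<noteq> a" "c \<noteq> b"
  shows "G \<simeq>\<^sub>G quasi_ladder_E6 \<or> G \<simeq>\<^sub>G quasi_ladder_E7"
proof -
  let ?L = "range X \<union> range Y"
  note dist = half_ladder_distinct[OF ladder]
  have X0: "nbrs G (X 0) = {X 1, Y 0, a}" using nbrs_end[OF ladder ab(1,4)] .
  have Y0: "nbrs G (Y 0) = {Y 1, X 0, b}"
    using nbrs_end[OF half_ladder_swap[OF ladder] ab(2)] ab(5) by auto
  have e: "a \<leftrightarrow> c" "b \<leftrightarrow> c" using c by (metis insertCI mem_nbrs)+
  show ?thesis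
  proof (rule nbrs_cases_2[of c a b])
    assume nc: "nbrs G c = {a, b}"
    have "G \<simeq>\<^sub>G quasi_ladder_E6"
      unfolding quasi_ladder_E6_def
      by (rule half_ladder_with_iso[OF ladder, where f = "case_qvertex X Y a a b c a a"])
        (use ab c X0 Y0 nc in \<open>auto simp: end_nbrs_simps\<close>)
    then show ?thesis ..
  next
    fix p assume p: "p \<noteq> a" "p \<noteq> b" "nbrs G c = {a, b, p}"
    then have cp: "c \<leftrightarrow> p" by (metis insertCI mem_nbrs)
    then have pc: "p \<noteq> c" by auto
    have "\<not> X 0 \<leftrightarrow> c" "\<not> Y 0 \<leftrightarrow> c"
      using edge_in_nbrs[OF _ X0, of c] edge_in_nbrs[OF _ Y0, of c] c by auto
    then have pL: "p \<notin> ?L" using half_ladder_exit[OF ladder _ edge_sym[OF cp] c(3)] edge_sym[OF cp] by metis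
    have np: "\<not> X 0 \<leftrightarrow> p" "\<not> Y 0 \<leftrightarrow> p" "\<not> a \<leftrightarrow> p" "\<not> b \<leftrightarrow> p"
      using edge_in_nbrs[OF _ X0, of p] edge_in_nbrs[OF _ Y0, of p] edge_in_nbrs[OF _ c(1), of p]
        edge_in_nbrs[OF _ c(2), of p] pL pc p by auto
    have "nbrs G p = {c}"
    proof (rule pendant[of c p a b])
      fix q assume q: "p \<leftrightarrow> q" "q \<noteq> c"
      have qL: "q \<notin> ?L" using half_ladder_exit[OF ladder _ edge_sym[OF q(1)] pL] np edge_sym[OF q(1)] by metis
      have qab: "q \<noteq> a" "q \<noteq> b" using np q edge_sym by auto
      have nq: "\<not> X 0 \<leftrightarrow> q" "\<not> Y 0 \<leftrightarrow> q" "\<not> a \<leftrightarrow> q" "\<not> b \<leftrightarrow> q" "\<not> c \<leftrightarrow> q"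
        using edge_in_nbrs[OF _ X0, of q] edge_in_nbrs[OF _ Y0, of q] edge_in_nbrs[OF _ c(1), of q]
          edge_in_nbrs[OF _ c(2), of q] edge_in_nbrs[OF _ p(3), of q] qL q qab by auto
      have "\<not> w \<leftrightarrow> q" if "a \<leftrightarrow> w \<or> b \<leftrightarrow> w" for w
        using that edge_in_nbrs[OF _ c(1), of w] edge_in_nbrs[OF _ c(2), of w] nq by auto
      then show "gdist G a q \<ge> 3 \<and> gdist G b q \<ge> 3"
        using nq qab q(1) e edge_verts by (intro conjI gdist_ge_3I) auto
    qed (use p ab in auto)
    then have "G \<simeq>\<^sub>G quasi_ladder_E7"
      unfolding quasi_ladder_E7_def
      by (intro half_ladder_with_iso[OF ladder, where f = "case_qvertex X Y a a b c p a"])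
        (use ab c X0 Y0 p pL pc in \<open>auto simp: end_nbrs_simps\<close>)
    then show ?thesis ..
  qed (use e edge_sym ab in auto)
qed

lemma one_pendant_iso:
  assumes maximal: "end_ladder X Y" and Y0: "nbrs G (Y 0) = {Y 1, X 0}"
    and a: "X 0 \<leftrightarrow> a" "a \<notin> range X \<union> range Y"
  shows "G \<simeq>\<^sub>G quasi_ladder_E2"
proof -
  have ladder: "half_ladder X Y" using maximal by (simp add: end_ladder_def)
  have X0: "nbrs G (X 0) = {X 1, Y 0, a}" using nbrs_end[OF ladder a] .
  have no: "w \<in> range X \<union> range Y" if "Y 0 \<leftrightarrow> w" for w using edge_in_nbrs[OF that Y0] by auto
  show ?thesis
  proof (rule nbrs_beyond_end[OF maximal a])
    show "\<not> a \<leftrightarrow> Y 0" using no[of a] a(2) edge_sym by blast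
    assume "nbrs G a = {X 0}"
    then show ?thesis
      unfolding quasi_ladder_E2_def
      by (intro half_ladder_with_iso[OF ladder, where f = "case_qvertex X Y a a a a a a"])
        (use a X0 Y0 in \<open>auto simp: end_nbrs_simps\<close>)
  qed (use no in blast)
qed

lemma end_ladder_iso:
  assumes maximal: "end_ladder X Y"
  shows "G \<simeq>\<^sub>G quasi_ladder_E1 \<or> G \<simeq>\<^sub>G quasi_ladder_E2 \<or> G \<simeq>\<^sub>G quasi_ladder_E3 \<or>
    G \<simeq>\<^sub>G quasi_ladder_E4 \<or> G \<simeq>\<^sub>G quasi_ladder_E5 \<or> G \<simeq>\<^sub>G quasi_ladder_E6 \<or> G \<simeq>\<^sub>G quasi_ladder_E7"
proof -
  let ?L = "range X \<union> range Y"
  have ladder: "half_ladder X Y" using maximal by (simp add: end_ladder_def)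
  note dist = half_ladder_distinct[OF ladder]
  have cases: "nbrs G (X 0) = {X 1, Y 0} \<or> (\<exists>a. X 0 \<leftrightarrow> a \<and> a \<notin> range X \<union> range Y)"
    if "half_ladder X Y" for X Y
  proof (rule ccontr)
    assume no: "\<not> ?thesis"
    have "a \<in> {X 1, Y 0}" if Xa: "X 0 \<leftrightarrow> a" for a
    proof -
      have "a \<in> range X \<union> range Y" using no Xa by blast
      then consider n where "a = X n" | n where "a = Y n" by blast
      then show ?thesis
      proof cases
        case 1
        then obtain m where m: "n = Suc m" using Xa by (cases n) auto
        then show ?thesis
          using edge_in_nbrs[OF edge_sym[OF Xa]] half_ladder_interior(1)[OF \<open>half_ladder X Y\<close>, of m] 1
            half_ladder_distinct[OF \<open>half_ladder X Y\<close>] by auto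
      next
        case 2
        then show ?thesis
          using edge_in_nbrs[OF edge_sym[OF Xa]] half_ladder_interior(2)[OF \<open>half_ladder X Y\<close>]
            half_ladder_distinct[OF \<open>half_ladder X Y\<close>] by (cases n) auto
      qed
    qed
    then have "nbrs G (X 0) \<subseteq> {X 1, Y 0}" by (simp add: subset_iff)
    then have "nbrs G (X 0) = {X 1, Y 0}"
      using half_ladder_edges[OF that, of 0] by (intro equalityI) auto
    then show False using no by blast
  qed
  consider (none) "nbrs G (X 0) = {X 1, Y 0}" "nbrs G (Y 0) = {Y 1, X 0}"
    | (left) a where "nbrs G (Y 0) = {Y 1, X 0}" "X 0 \<leftrightarrow> a" "a \<notin> ?L"
    | (right) b where "nbrs G (X 0) = {X 1, Y 0}" "Y 0 \<leftrightarrow> b" "b \<notin> ?L"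
    | (both) a b where "X 0 \<leftrightarrow> a" "a \<notin> ?L" "Y 0 \<leftrightarrow> b" "b \<notin> ?L"
    using cases[OF ladder] cases[OF half_ladder_swap[OF ladder]] by blast
  then show ?thesis
  proof cases
    case none
    then have "G \<simeq>\<^sub>G quasi_ladder_E1"
      unfolding quasi_ladder_E1_def
      by (intro half_ladder_with_iso[OF ladder, where f = "case_qvertex X Y (X 0) (X 0) (X 0) (X 0) (X 0) (X 0)"])
        (auto simp: end_nbrs_simps)
    then show ?thesis by blast
  next
    case (left a)
    then show ?thesis using one_pendant_iso[OF maximal] by blast
  next
    case (right b)
    then have "b \<notin> range Y \<union> range X" by blast
    \<comment> \<open>Exchanging the two sides reduces this to the previous case and yields the same
      model.\<close>
    then show ?thesis using one_pendant_iso[OF end_ladder_swap[OF maximal] right(1,2)] by blast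
  next
    case (both a b)
    show ?thesis
    proof (cases "a = b")
      case True
      then show ?thesis using triangle_end_iso[OF ladder both(1)] both by blast
    next
      case ne: False
      have X0: "nbrs G (X 0) = {X 1, Y 0, a}" using nbrs_end[OF ladder both(1,2)] .
      have bL: "b \<notin> range Y \<union> range X" using both by blast
      have Y0: "nbrs G (Y 0) = {Y 1, X 0, b}"
        using nbrs_end[OF half_ladder_swap[OF ladder] both(3) bL] .
      have w_eq: "w = b" if "Y 0 \<leftrightarrow> w" "w \<notin> ?L" for w using edge_in_nbrs[OF that(1) Y0] that(2) by auto
      have w_eq': "w = a" if "X 0 \<leftrightarrow> w" "w \<notin> range Y \<union> range X" for w
        using edge_in_nbrs[OF that(1) X0] that(2) by auto
      have nab: "\<not> a \<leftrightarrow> Y 0" "\<not> b \<leftrightarrow> X 0" using w_eq w_eq' both bL ne edge_sym by blast+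
      \<comment> \<open>As b is the only outside neighbour of \<open>Y 0\<close>, and a that of
        \<open>X 0\<close>, the vertex w in \<open>nbrs_beyond_end\<close> is forced. So a and b are
        either both pendant or joined through a common c.\<close>
      show ?thesis
      proof (rule nbrs_beyond_end[OF maximal both(1,2) nab(1)])
        assume na: "nbrs G a = {X 0}"
        show ?thesis
        proof (rule nbrs_beyond_end[OF end_ladder_swap[OF maximal] both(3) bL nab(2)])
          assume nb: "nbrs G b = {Y 0}"
          have "G \<simeq>\<^sub>G quasi_ladder_E3"
            unfolding quasi_ladder_E3_def
            by (rule half_ladder_with_iso[OF ladder, where f = "case_qvertex X Y a a a a a b"])
              (use both ne X0 Y0 na nb in \<open>auto simp: end_nbrs_simps\<close>)
          then show ?thesis by blast
        next
          fix c w assume "nbrs G b = {Y 0, c}" "c \<notin> range Y \<union> range X"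
            "X 0 \<leftrightarrow> w" "w \<notin> range Y \<union> range X" "w \<leftrightarrow> c"
          then show ?thesis using w_eq' na edge_in_nbrs[of a c] by blast
        qed
      next
        fix c w assume c: "nbrs G a = {X 0, c}" "c \<noteq> a" "c \<notin> ?L" "Y 0 \<leftrightarrow> w" "w \<notin> ?L" "w \<leftrightarrow> c"
        then have bc: "b \<leftrightarrow> c" using w_eq by blast
        have "nbrs G b = {Y 0, c}"
        proof (rule nbrs_beyond_end[OF end_ladder_swap[OF maximal] both(3) bL nab(2)])
          assume "nbrs G b = {Y 0}"
          then show ?thesis using edge_in_nbrs[OF bc] c(3) by blast
        next
          fix c' assume "nbrs G b = {Y 0, c'}"
          then show ?thesis using edge_in_nbrs[OF bc] c(3) by blast
        qed
        moreover have "c \<noteq> b" using bc by auto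
        ultimately have "G \<simeq>\<^sub>G quasi_ladder_E6 \<or> G \<simeq>\<^sub>G quasi_ladder_E7"
          using pentagon_end_iso[OF ladder both(1,3) ne both(2,4) c(1) _ c(3,2)] by blast
        then show ?thesis by blast
      qed
    qed
  qed
qed

end

theorem theorem1p2:
  fixes G :: "'v ugraph"
  assumes "in_class_G G"
    and "infinite (verts G)"
  shows "G \<simeq>\<^sub>G both_side_line \<or>
         G \<simeq>\<^sub>G one_side_line \<or>
         G \<simeq>\<^sub>G infinite_ladder \<or>
         G \<simeq>\<^sub>G quasi_ladder_E1 \<or>
         G \<simeq>\<^sub>G quasi_ladder_E2 \<or>
         G \<simeq>\<^sub>G quasi_ladder_E3 \<or>
         G \<simeq>\<^sub>G quasi_ladder_E4 \<or>
         G \<simeq>\<^sub>G quasi_ladder_E5 \<or>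
         G \<simeq>\<^sub>G quasi_ladder_E6 \<or>
         G \<simeq>\<^sub>G quasi_ladder_E7"
proof -
  interpret ricci_graph G
    using assms(1) by unfold_locales (auto simp: in_class_G_def)
  show ?thesis
  proof (cases "\<forall>u\<in>verts G. vdeg G u \<le> 2")
    case True
    then show ?thesis using line_cases[OF assms(2)] by blast
  next
    case False
    then obtain u where "u \<in> verts G" "vdeg G u = 3"
      using degree_le by (metis le_antisym not_less_eq_eq numeral_2_eq_2 numeral_3_eq_3)
    then obtain X Y where ladder: "half_ladder X Y"
      using half_ladder_exists[OF assms(2)] by blast
    show ?thesis
    \<comment> \<open>The maximal ladder may be unrelated to the one just found; if there is none,
      every half-infinite ladder can be prolonged, as the two-sided construction requires.\<close>
    proof (cases "\<exists>X Y. end_ladder X Y")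
      case True
      then show ?thesis using end_ladder_iso by blast
    next
      case False
      then have "G \<simeq>\<^sub>G infinite_ladder"
        using infinite_ladder_iso[OF ladder] unfolding end_ladder_def by blast
      then show ?thesis by blast
    qed
  qed
qed

end
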